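(* For $j=0,1,2,\dots$ we have \[ D[n,j]\sim\frac{\alpha_2}{\alpha}\,\zeta_j\,n^{\alpha}\quad\text{almost surely as } n\to\infty, \] where $\zeta_j$ is the positive random variable for which $W[n,j]\sim\zeta_j n^{\alpha}$ almost surely as $n\to\infty$.
   Context: Random graph model with parameters $0<p\le 1$, $q,r\in[0,1]$. Vertices, edges and triangles carry nonnegative integer weights. At time $0$ there is a single triangle on three vertices; the triangle has weight $1$ and each of its three edges has weight $1$ (all other pairs/triplets have weight $0$). At each step $n=1,2,\dots$ three vertices interact, chosen as follows, all the choices of rule being independent of the past. With probability $p$ a new vertex is added and it interacts with two distinct old vertices: with (conditional) probability $r$ these are the endpoints of an edge chosen with probability proportional to its weight, and with probability $1-r$ they are two distinct old vertices chosen uniformly at random. With probability $1-p$ three old vertices interact: with (conditional) probability $q$ a triangle is chosen with probability proportional to its weight, and with probability $1-q$ three distinct old vertices are chosen uniformly at random. After the three interacting vertices are selected, any missing edges among them are drawn, and the weight of the triangle they form and of each of its three edges is increased by $1$. The weight of a vertex is the sum of the weights of the triangles containing it; its degree is its number of neighbours. The three initial vertices are labelled $-2,-1,0$; later vertices are labelled $1,2,\dots$ in the order they are added. $W[n,j]$ and $D[n,j]$ are the weight and the degree of vertex $j$ after step $n$ if it exists by then, and $0$ otherwise. Constants: $\alpha_1=(1-p)q$, $\alpha_2=\frac{2pr}{3}$, $\alpha=\alpha_1+\alpha_2$. Known fact (from earlier work) defining $\zeta_j$: for each fixed $j\ge0$, $W[n,j]\sim\zeta_j n^{\alpha}$ almost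 surely as $n\to\infty$, where $\zeta_j$ is a positive random variable.
   Formalization: When r = 0 (so α₂ = 0) the claimed limit constant is 0 and "D[n,j] ~ 0" fails literally, since D[0,0] = 2 and degrees never decrease; in that case the statement is read as D[n,j] = o(n^α). When α = 0 no such ζ_j exists and nothing is claimed. *)

theory Defs
  imports "HOL-Probability.Probability"
begin

text \<open>
  Vertices are integer labels, and edges and triangles are sets of two and three labels.
  The integer weights of edges and triangles are multiplicities in multisets, so that
  \<^const>\<open>pmf_of_multiset\<close> draws an edge or a triangle with probability proportional to its
  weight; pairs and triplets that do not occur in the multisets have weight 0.
\<close>

record graph_state =
  vertices :: "int set"
  edges :: "int set set"
  edge_weights :: "int set multiset"
  triangle_weights :: "int set multiset"

definition subsets_of_size :: "nat \<Rightarrow> int set \<Rightarrow> int set set" where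
  "subsets_of_size k A = {B. B \<subseteq> A \<and> card B = k}"

definition initial_state :: graph_state where
  "initial_state =
     \<lparr>vertices = {-2, -1, 0},
      edges = {{-2, -1}, {-2, 0}, {-1, 0}},
      edge_weights = {#{-2, -1}, {-2, 0}, {-1, 0}#},
      triangle_weights = {#{-2, -1, 0}#}\<rparr>"

text \<open>The first added vertex gets label 1, since the largest initial label is 0.\<close>

definition new_vertex :: "graph_state \<Rightarrow> int" where
  "new_vertex s = Max (vertices s) + 1"

definition interacting_triple :: "real \<Rightarrow> real \<Rightarrow> real \<Rightarrow> graph_state \<Rightarrow> int set pmf" where
  "interacting_triple p q r s =
     bind_pmf (bernoulli_pmf p) (\<lambda>add.
       if add then
         map_pmf (insert (new_vertex s))
           (bind_pmf (bernoulli_pmf r) (\<lambda>by_weight.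
              if by_weight then pmf_of_multiset (edge_weights s)
              else pmf_of_set (subsets_of_size 2 (vertices s))))
       else
         bind_pmf (bernoulli_pmf q) (\<lambda>by_weight.
           if by_weight then pmf_of_multiset (triangle_weights s)
           else pmf_of_set (subsets_of_size 3 (vertices s))))"

definition interact :: "graph_state \<Rightarrow> int set \<Rightarrow> graph_state" where
  "interact s T =
     \<lparr>vertices = vertices s \<union> T,
      edges = edges s \<union> subsets_of_size 2 T,
      edge_weights = edge_weights s + mset_set (subsets_of_size 2 T),
      triangle_weights = add_mset T (triangle_weights s)\<rparr>"

definition step :: "real \<Rightarrow> real \<Rightarrow> real \<Rightarrow> graph_state \<Rightarrow> graph_state pmf" where
  "step p q r s = map_pmf (interact s) (interacting_triple p q r s)"

text \<open>
  The state after step \<open>n\<close> is \<open>X n\<close>. The last clause says that, given the whole past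
  \<open>X 0, \<dots>, X n\<close>, the next state has law \<open>step p q r (X n)\<close>; it is multiplied out so that
  histories of probability 0 need no special treatment.
\<close>

definition three_interactions_process ::
    "real \<Rightarrow> real \<Rightarrow> real \<Rightarrow> 'a measure \<Rightarrow> (nat \<Rightarrow> 'a \<Rightarrow> graph_state) \<Rightarrow> bool" where
  "three_interactions_process p q r M X \<longleftrightarrow>
     prob_space M \<and>
     (\<forall>n. X n \<in> measurable M (count_space UNIV)) \<and>
     (AE \<omega> in M. X 0 \<omega> = initial_state) \<and>
     (\<forall>n h s.
        measure M {\<omega> \<in> space M. (\<forall>i\<le>n. X i \<omega> = h i) \<and> X (Suc n) \<omega> = s} =
        measure M {\<omega> \<in> space M. \<forall>i\<le>n. X i \<omega> = h i} * pmf (step p q r (h n)) s)"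

text \<open>Both quantities below are 0 for a label that has not been used yet.\<close>

definition vertex_weight :: "graph_state \<Rightarrow> int \<Rightarrow> nat" where
  "vertex_weight s j =
     (\<Sum>T | T \<in># triangle_weights s \<and> j \<in> T. count (triangle_weights s) T)"

definition vertex_degree :: "graph_state \<Rightarrow> int \<Rightarrow> nat" where
  "vertex_degree s j = card {i. i \<noteq> j \<and> {i, j} \<in> edges s}"

definition alpha1 :: "real \<Rightarrow> real \<Rightarrow> real" where
  "alpha1 p q = (1 - p) * q"

definition alpha2 :: "real \<Rightarrow> real \<Rightarrow> real" where
  "alpha2 p r = 2 * p * r / 3"

definition alpha :: "real \<Rightarrow> real \<Rightarrow> real \<Rightarrow> real" where
  "alpha p q r = alpha1 p q + alpha2 p r"

end

theory Submission
  imports Defs "HOL-Real_Asymp.Real_Asymp"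
begin

text \<open>
  Let \<open>W n\<close> and \<open>D n\<close> be the weight and the degree of the vertex \<open>j\<close> after step \<open>n\<close>, and write
  \<open>\<alpha>\<close> and \<open>\<alpha>\<^sub>2\<close> for the constants \<open>alpha p q r\<close> and \<open>alpha2 p r\<close>.
  The weight of an edge or triangle is what a preferential choice sees. Since every triangle at \<open>j\<close>
  brings two edges at \<open>j\<close>, a weighted edge contains \<open>j\<close> with probability \<open>2/3 * W n / (n + 1)\<close>. Such a
  choice is made with a newly arriving vertex, which becomes the one new neighbour of \<open>j\<close>. A
  preferentially chosen triangle creates no new neighbour. Uniform choices hit \<open>j\<close> only with
  probability of the order of the reciprocal number of vertices, that is, \<open>1 / n\<close>. Hence, given the past,
  \<open>D\<close> grows at step \<open>n + 1\<close> by \<open>\<alpha>\<^sub>2 * W n / (n + 1) + O(1 / n)\<close> on average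
  (\<open>expected_degree_gain\<close>). With \<open>W n\<close> close to \<open>\<zeta> * n powr \<alpha>\<close> these conditional means add up to
  a quantity asymptotic to \<open>\<alpha>\<^sub>2 / \<alpha> * \<zeta> * n powr \<alpha>\<close>; the uniform choices contribute only a
  multiple of \<open>ln n\<close>.

  It remains to compare \<open>D\<close> with the sum of its conditional mean increments. This is the purpose of
  \<open>strong_law\<close>: if increments of a functional of a Markov chain lie in a bounded interval starting
  at 0 and their conditional means, divided by the increments of a norming sequence \<open>b\<close>, converge
  almost surely, then the normalised sum of the increments has the same limit. The variance of a
  bounded nonnegative increment is at most a multiple of its mean, so the second moment of the
  centred sum is of order \<open>b n\<close> once large conditional means have been truncated away. Chebyshev's
  inequality and Borel--Cantelli give convergence along a subsequence on which \<open>b\<close> runs through the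
  squares, and monotonicity fills the gaps.

  The same law serves three times: with \<open>b n = n\<close> it shows that the number of vertices is
  asymptotically \<open>p * n\<close>; with \<open>b n = n powr \<alpha>\<close> it gives the degree; and with \<open>b n = ln (n + 1)\<close> it
  shows that \<open>\<alpha> = 0\<close> is incompatible with the assumed growth of the weight, since the weight would
  grow logarithmically (\<open>alpha_pos\<close>).
\<close>

section \<open>Limits along a norming sequence\<close>

text \<open>
  The normalisations below are \<open>n\<close>, \<open>n powr \<gamma>\<close> with \<open>0 < \<gamma> \<le> 1\<close>, and \<open>ln (n + 1)\<close>. Their common
  features are collected here. Bounded increments are what makes the subsequence below as fine as
  \<open>b\<close> itself: \<open>b\<close> cannot jump far over the squares.
\<close>

locale norming =
  fixes b :: "nat \<Rightarrow> real" and d :: real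
  assumes b_0: "b 0 = 0"
    and b_less_Suc: "b n < b (Suc n)"
    and b_at_top: "filterlim b at_top sequentially"
    and b_increment_le: "b (Suc n) - b n \<le> d"
begin

lemma strict_mono_b: "strict_mono b"
  by (simp add: strict_mono_Suc_iff b_less_Suc)

lemma b_mono: "m \<le> n \<Longrightarrow> b m \<le> b n"
  using strict_mono_b by (simp add: strict_mono_less_eq)

lemma b_nonneg: "0 \<le> b n"
  using b_mono[of 0 n] b_0 by simp

lemma b_pos: "0 < n \<Longrightarrow> 0 < b n"
  using strict_mono_b b_0 by (metis strict_mono_less)

text \<open>
  From some index on, each \<open>a n\<close> differs from \<open>L\<close> times the increment of \<open>b\<close> by at most a small
  multiple of that increment; these errors telescope, and the finitely many early terms are
  swallowed because \<open>b\<close> is unbounded.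
\<close>

lemma stolz_cesaro:
  assumes lim: "(\<lambda>n. a n / (b (Suc n) - b n)) \<longlonglongrightarrow> L"
  shows "(\<lambda>n. (\<Sum>k<n. a k) / b n) \<longlonglongrightarrow> L"
proof (rule LIMSEQ_I)
  fix e :: real assume "e > 0"
  then obtain N where N: "\<And>n. n \<ge> N \<Longrightarrow> \<bar>a n / (b (Suc n) - b n) - L\<bar> < e / 2"
    using LIMSEQ_D[OF lim, of "e / 2"] by auto
  have term_le: "\<bar>a n - L * (b (Suc n) - b n)\<bar> \<le> e / 2 * (b (Suc n) - b n)" if "n \<ge> N" for n
  proof -
    have pos: "b (Suc n) - b n > 0" using b_less_Suc[of n] by simp
    have "a n - L * (b (Suc n) - b n) = (a n / (b (Suc n) - b n) - L) * (b (Suc n) - b n)"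
      using pos by (simp add: left_diff_distrib)
    then have "\<bar>a n - L * (b (Suc n) - b n)\<bar> = \<bar>a n / (b (Suc n) - b n) - L\<bar> * (b (Suc n) - b n)"
      using pos by (simp only: abs_mult abs_of_pos)
    also have "\<dots> \<le> e / 2 * (b (Suc n) - b n)"
      using N[OF that] pos by (intro mult_right_mono) auto
    finally show ?thesis .
  qed
  define C where "C = \<bar>(\<Sum>k<N. a k) - L * b N\<bar>"
  have bound: "\<bar>(\<Sum>k<n. a k) - L * b n\<bar> \<le> C + e / 2 * (b n - b N)" if "n \<ge> N" for n
    using that
  proof (induction n rule: dec_induct)
    case base
    show ?case by (simp add: C_def)
  next
    case (step n)
    have "(\<Sum>k<Suc n. a k) - L * b (Suc n) = ((\<Sum>k<n. a k) - L * b n) + (a n - L * (b (Suc n) - b n))"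
      by (simp add: algebra_simps)
    also have "\<bar>\<dots>\<bar> \<le> (C + e / 2 * (b n - b N)) + e / 2 * (b (Suc n) - b n)"
      using step.IH term_le[OF step.hyps(1)] by linarith
    also have "\<dots> = C + e / 2 * (b (Suc n) - b N)"
      by (simp add: field_simps)
    finally show ?case .
  qed
  obtain N' where N': "\<And>n. n \<ge> N' \<Longrightarrow> b n > 2 * C / e"
    using b_at_top unfolding filterlim_at_top_dense eventually_sequentially by metis
  show "\<exists>no. \<forall>n\<ge>no. norm ((\<Sum>k<n. a k) / b n - L) < e"
  proof (intro exI[of _ "max (max N N') 1"] allI impI)
    fix n assume n: "n \<ge> max (max N N') 1"
    have pos: "b n > 0" using n by (intro b_pos) auto
    have "\<bar>(\<Sum>k<n. a k) - L * b n\<bar> \<le> C + e / 2 * (b n - b N)" using bound n by simp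
    also have "\<dots> \<le> C + e / 2 * b n" using b_nonneg[of N] \<open>e > 0\<close> by (simp add: field_simps)
    also have "\<dots> < e * b n" using N'[of n] n \<open>e > 0\<close> by (simp add: field_simps)
    finally have "\<bar>(\<Sum>k<n. a k) - L * b n\<bar> / b n < e" using pos by (simp add: field_simps)
    moreover have "(\<Sum>k<n. a k) / b n - L = ((\<Sum>k<n. a k) - L * b n) / b n"
      using pos by (simp add: field_simps)
    ultimately show "norm ((\<Sum>k<n. a k) / b n - L) < e" using pos by simp
  qed
qed

text \<open>
  The subsequence is thin enough for Chebyshev bounds of order \<open>1 / b\<close> to be summable along it
  (\<open>b\<close> is about \<open>k\<^sup>2\<close> there), and dense enough for consecutive values of \<open>b\<close> to have ratio tending
  to 1, so that a nearly monotone sequence can be interpolated.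
\<close>

definition sq_time :: "nat \<Rightarrow> nat" where
  "sq_time k = (LEAST n. (real k)\<^sup>2 \<le> b n)"

lemma sq_time_iff: "sq_time k \<le> n \<longleftrightarrow> (real k)\<^sup>2 \<le> b n"
proof -
  obtain m where "(real k)\<^sup>2 \<le> b m"
    using b_at_top unfolding filterlim_at_top eventually_sequentially by blast
  then have "(real k)\<^sup>2 \<le> b (sq_time k)" unfolding sq_time_def by (rule LeastI)
  then show ?thesis
    using b_mono[of "sq_time k" n] unfolding sq_time_def
    by (meson Least_le order_trans)
qed

lemma sq_time_ge: "(real k)\<^sup>2 \<le> b (sq_time k)"
  using sq_time_iff by blast

lemma sq_time_le: "b (sq_time k) \<le> (real k)\<^sup>2 + d"
proof (cases "sq_time k")
  case 0
  then show ?thesis using b_0 b_less_Suc[of 0] b_increment_le[of 0] by simp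
next
  case (Suc n)
  then have "b n < (real k)\<^sup>2" using sq_time_iff[of k n] by simp
  then show ?thesis using b_increment_le[of n] Suc by simp
qed

text \<open>
  The one-sided control says that \<open>S\<close> never decreases by more than \<open>C\<close> times the growth of \<open>b\<close>.
  Between two consecutive times of the subsequence, \<open>S\<close> is therefore squeezed between its values at
  these times up to \<open>C\<close> times the growth of \<open>b\<close> over the block, which is of smaller order than \<open>b\<close>.
\<close>

lemma interpolation:
  assumes mono: "mono (\<lambda>n. S n + C * b n)"
    and sub: "(\<lambda>k. S (sq_time k) / (real k)\<^sup>2) \<longlonglongrightarrow> 0"
    and "0 \<le> C"
  shows "(\<lambda>n. S n / b n) \<longlonglongrightarrow> 0"
proof -
  \<comment> \<open>the block of \<open>n\<close>: \<open>k\<^sup>2 \<le> b n < (k + 1)\<^sup>2\<close> for \<open>k = kk n\<close>\<close>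
  define kk where "kk = (\<lambda>n. nat \<lfloor>sqrt (b n)\<rfloor>)"
  define e where "e = (\<lambda>k. \<bar>S (sq_time k)\<bar> / (real k)\<^sup>2
     + \<bar>S (sq_time (Suc k)) / (real (Suc k))\<^sup>2\<bar> * ((real (Suc k))\<^sup>2 / (real k)\<^sup>2)
     + C * ((real (Suc k))\<^sup>2 + d - (real k)\<^sup>2) / (real k)\<^sup>2)"
  have "filterlim (\<lambda>n. sqrt (b n)) at_top sequentially"
    by (rule filterlim_compose[OF sqrt_at_top b_at_top])
  then have kk_top: "filterlim kk at_top sequentially"
    unfolding kk_def
    by (intro filterlim_compose[OF filterlim_nat_sequentially] filterlim_compose[OF filterlim_floor_sequentially])
  have 1: "(\<lambda>k. \<bar>S (sq_time k)\<bar> / (real k)\<^sup>2) \<longlonglongrightarrow> 0"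
    using tendsto_rabs_zero[OF sub] by (simp add: abs_divide)
  have 2: "(\<lambda>k. \<bar>S (sq_time (Suc k)) / (real (Suc k))\<^sup>2\<bar>) \<longlonglongrightarrow> 0"
    using LIMSEQ_Suc[OF tendsto_rabs_zero[OF sub]] .
  have 3: "(\<lambda>k. (real (Suc k))\<^sup>2 / (real k)\<^sup>2) \<longlonglongrightarrow> 1"
    by real_asymp
  have 4: "(\<lambda>k. C * ((real (Suc k))\<^sup>2 + d - (real k)\<^sup>2) / (real k)\<^sup>2) \<longlonglongrightarrow> 0"
    by real_asymp
  have "e \<longlonglongrightarrow> 0"
    unfolding e_def using tendsto_add[OF tendsto_add[OF 1 tendsto_mult[OF 2 3]] 4] by simp
  then have lim: "(\<lambda>n. e (kk n)) \<longlonglongrightarrow> 0"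
    by (rule filterlim_compose[OF _ kk_top])
  show ?thesis
  proof (rule Lim_null_comparison[OF _ lim])
    have "eventually (\<lambda>n. kk n \<ge> 1) sequentially"
      using kk_top by (simp add: filterlim_at_top)
    then show "eventually (\<lambda>n. norm (S n / b n) \<le> e (kk n)) sequentially"
    proof eventually_elim
      case (elim n)
      define k where "k = kk n"
      have k: "k \<ge> 1" using elim by (simp add: k_def)
      have "real k \<le> sqrt (b n)" unfolding k_def kk_def using b_nonneg[of n] by simp
      then have lo: "(real k)\<^sup>2 \<le> b n"
        using power_mono[of "real k" "sqrt (b n)" 2] b_nonneg[of n] by simp
      have "sqrt (b n) < real (Suc k)" unfolding k_def kk_def using b_nonneg[of n]
        by linarith
      then have hi: "b n < (real (Suc k))\<^sup>2"
        using real_sqrt_less_iff[of "b n" "(real (Suc k))\<^sup>2"] by simp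
      have k1: "sq_time k \<le> n" using lo sq_time_iff by simp
      have k2: "n \<le> sq_time (Suc k)" using hi sq_time_iff[of "Suc k" n] by linarith
      have bk: "b (sq_time (Suc k)) - b (sq_time k) \<le> (real (Suc k))\<^sup>2 + d - (real k)\<^sup>2"
        using sq_time_le[of "Suc k"] sq_time_ge[of k] by linarith
      have m1: "S (sq_time k) + C * b (sq_time k) \<le> S n + C * b n"
        and m2: "S n + C * b n \<le> S (sq_time (Suc k)) + C * b (sq_time (Suc k))"
        using monoD[OF mono k1] monoD[OF mono k2] by auto
      have m3: "C * (b n - b (sq_time k)) \<le> C * (b (sq_time (Suc k)) - b (sq_time k))"
        "C * (b (sq_time (Suc k)) - b n) \<le> C * (b (sq_time (Suc k)) - b (sq_time k))"
        using b_mono[OF k1] b_mono[OF k2] \<open>0 \<le> C\<close> by (auto intro!: mult_left_mono)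
      have m4: "C * (b (sq_time (Suc k)) - b (sq_time k)) \<le> C * ((real (Suc k))\<^sup>2 + d - (real k)\<^sup>2)"
        using bk \<open>0 \<le> C\<close> by (rule mult_left_mono)
      have "\<bar>S n\<bar> \<le> \<bar>S (sq_time k)\<bar> + \<bar>S (sq_time (Suc k))\<bar> + C * ((real (Suc k))\<^sup>2 + d - (real k)\<^sup>2)"
        using m1 m2 m3 m4 by (simp add: algebra_simps)
      also have "\<dots> = e k * (real k)\<^sup>2"
        unfolding e_def using k by (simp add: field_simps abs_divide)
      finally have main: "\<bar>S n\<bar> \<le> e k * (real k)\<^sup>2" .
      have kpos: "(real k)\<^sup>2 > 0" using k by simp
      have "e k \<ge> 0"
        using main kpos abs_ge_zero[of "S n"] by (meson order_trans zero_le_mult_iff less_le_not_le)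
      then have "\<bar>S n\<bar> \<le> e k * b n"
        using main mult_left_mono[OF lo, of "e k"] by linarith
      moreover have "b n > 0" using kpos lo by linarith
      ultimately show ?case by (simp add: k_def divide_le_eq)
    qed
  qed
qed

end

lemma norming_of_nat: "norming real 1"
  by unfold_locales (simp_all add: filterlim_real_sequentially)

lemma norming_powr:
  assumes "0 < \<gamma>" "\<gamma> \<le> 1"
  shows "norming (\<lambda>n. real n powr \<gamma>) 1"
proof
  show "real 0 powr \<gamma> = 0" by simp
  show "real n powr \<gamma> < real (Suc n) powr \<gamma>" for n
    using assms by (intro powr_less_mono2) auto
  show "filterlim (\<lambda>n. real n powr \<gamma>) at_top sequentially"
    using assms by real_asymp
  show "real (Suc n) powr \<gamma> - real n powr \<gamma> \<le> 1" for n
  proof (cases "n = 0")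
    case False
    have split: "x powr \<gamma> = x * x powr (\<gamma> - 1)" if "x > 0" for x :: real
      using that by (simp add: powr_diff)
    \<comment> \<open>Write \<open>x powr \<gamma>\<close> as \<open>x * x powr (\<gamma> - 1)\<close>; the second factor decreases in \<open>x\<close>
      and is at most 1 from 1 on.\<close>
    have "real n * real (Suc n) powr (\<gamma> - 1) \<le> real n * real n powr (\<gamma> - 1)"
      using assms False by (intro mult_left_mono powr_mono2') auto
    moreover have "real (Suc n) powr (\<gamma> - 1) \<le> 1"
      using assms powr_mono2'[of "1 - \<gamma>" 1 "real (Suc n)"] powr_mono2'[of "\<gamma> - 1" 1 "real (Suc n)"] by simp
    moreover have "real (Suc n) powr \<gamma> = real n * real (Suc n) powr (\<gamma> - 1) + real (Suc n) powr (\<gamma> - 1)"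
      using split[of "real (Suc n)"] by (simp add: distrib_right)
    ultimately show ?thesis
      using split[of "real n"] False by linarith
  qed simp
qed

lemma norming_ln: "norming (\<lambda>n. ln (real n + 1)) 1"
proof
  show "filterlim (\<lambda>n. ln (real n + 1)) at_top sequentially" by real_asymp
  show "ln (real (Suc n) + 1) - ln (real n + 1) \<le> 1" for n
  proof -
    have "ln (real (Suc n) + 1) - ln (real n + 1) = ln (1 + 1 / (real n + 1))"
      by (subst ln_divide_pos[symmetric]) (auto simp: field_simps)
    also have "\<dots> \<le> 1 / (real n + 1)" by (rule ln_add_one_self_le_self) simp
    also have "\<dots> \<le> 1" by simp
    finally show ?thesis .
  qed
qed auto

section \<open>The law of the history of a Markov chain\<close>

text \<open>
  Histories are lists with the most recent state first, so that one step of the chain is a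
  \<open>Cons\<close>. At time \<open>n\<close> a history has length \<open>n + 1\<close>.
\<close>

primrec history_pmf :: "('s \<Rightarrow> 's pmf) \<Rightarrow> 's \<Rightarrow> nat \<Rightarrow> 's list pmf" where
  "history_pmf K x0 0 = return_pmf [x0]"
| "history_pmf K x0 (Suc n) =
     bind_pmf (history_pmf K x0 n) (\<lambda>h. map_pmf (\<lambda>s. s # h) (K (hd h)))"

primrec history :: "(nat \<Rightarrow> 's) \<Rightarrow> nat \<Rightarrow> 's list" where
  "history x 0 = [x 0]"
| "history x (Suc n) = x (Suc n) # history x n"

text \<open>
  Sums \<open>u k\<close> over the transitions \<open>k \<rightarrow> k + 1\<close> of a history. The tail below the last transition has
  exactly as many entries as earlier transitions, which recovers the time \<open>k\<close> from the list.
\<close>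

fun transition_sum :: "(nat \<Rightarrow> 's \<Rightarrow> 's \<Rightarrow> real) \<Rightarrow> 's list \<Rightarrow> real" where
  "transition_sum u (t # s # h) = u (length h) s t + transition_sum u (s # h)"
| "transition_sum u h = 0"

lemma length_history [simp]: "length (history x n) = Suc n"
  by (induction n) auto

lemma history_eq_Cons: "\<exists>h. history x n = x n # h \<and> length h = n"
  by (cases n) auto

lemma hd_history [simp]: "hd (history x n) = x n"
  by (cases n) auto

lemma transition_sum_history: "transition_sum u (history x n) = (\<Sum>k<n. u k (x k) (x (Suc k)))"
proof (induction n)
  case (Suc n)
  obtain h where "history x n = x n # h" "length h = n" using history_eq_Cons by blast
  with Suc show ?case by simp
qed simp

lemma length_history_pmf: "h \<in> set_pmf (history_pmf K x0 n) \<Longrightarrow> length h = Suc n"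
  by (induction n arbitrary: h) auto

lemma history_eq_iff:
  "length l = Suc n \<Longrightarrow> history x n = l \<longleftrightarrow> (\<forall>i\<le>n. x i = l ! (n - i))"
proof (induction n arbitrary: l)
  case 0
  then show ?case by (cases l) auto
next
  case (Suc n)
  then obtain s l' where l: "l = s # l'" "length l' = Suc n" by (cases l) auto
  have "(\<forall>i\<le>Suc n. x i = l ! (Suc n - i)) \<longleftrightarrow> x (Suc n) = s \<and> (\<forall>i\<le>n. x i = l' ! (n - i))"
    using l by (auto simp: le_Suc_eq Suc_diff_le)
  then show ?case using Suc.IH[OF l(2)] l by auto
qed

lemma pmf_history_Suc:
  "pmf (history_pmf K x0 (Suc n)) (s # h) = pmf (history_pmf K x0 n) h * pmf (K (hd h)) s"
proof -
  have "pmf (map_pmf (\<lambda>t. t # l) (K (hd l))) (s # h) = pmf (K (hd h)) s * indicator {h} l" for l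
  proof (cases "l = h")
    case True
    then show ?thesis using pmf_map_inj'[of "\<lambda>t. t # h" "K (hd h)" s] by (simp add: inj_def)
  next
    case False
    then show ?thesis by (auto simp: pmf_eq_0_set_pmf)
  qed
  then show ?thesis
    by (simp add: pmf_bind measure_pmf_single)
qed

text \<open>
  Orthogonality of martingale differences: given a history \<open>h\<close>, the new difference has mean 0, so
  the cross term with the sum over \<open>h\<close> vanishes and only its conditional second moment is added.
\<close>

lemma second_moment_history:
  assumes bdd: "\<And>n s t. \<bar>u n s t\<bar> \<le> B"
    and mean: "\<And>n s. measure_pmf.expectation (K s) (u n s) = 0"
    and var: "\<And>n s. measure_pmf.expectation (K s) (\<lambda>t. (u n s t)\<^sup>2) \<le> c n"
  shows "(\<integral>\<^sup>+h. ennreal ((transition_sum u h)\<^sup>2) \<partial>history_pmf K x0 n) \<le> ennreal (\<Sum>k<n. c k)"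
proof (induction n)
  case 0
  show ?case by simp
next
  case (Suc n)
  have c: "c k \<ge> 0" for k
    by (rule order_trans[OF _ var[of undefined k]]) simp
  have step: "(\<integral>\<^sup>+s. ennreal ((transition_sum u (s # h))\<^sup>2) \<partial>K (hd h))
      \<le> ennreal ((transition_sum u h)\<^sup>2) + ennreal (c n)" if h: "h \<in> set_pmf (history_pmf K x0 n)" for h
  proof -
    obtain s0 l where l: "h = s0 # l" "length l = n"
      using length_history_pmf[OF h] by (cases h) auto
    let ?S = "transition_sum u h" and ?u = "u n s0"
    have square: "(?u s + ?S)\<^sup>2 = ?S\<^sup>2 + 2 * ?S * ?u s + (?u s)\<^sup>2" for s
      by (simp add: power2_eq_square algebra_simps)
    have i1: "integrable (K s0) ?u"
      by (rule measure_pmf.integrable_const_bound[where B = B]) (auto simp: bdd)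
    have i2: "integrable (K s0) (\<lambda>s. (?u s)\<^sup>2)"
      by (rule measure_pmf.integrable_const_bound[where B = "B\<^sup>2"])
         (auto simp: abs_le_square_iff[symmetric] intro: order_trans[OF bdd abs_ge_self])
    have "(\<integral>\<^sup>+s. ennreal ((transition_sum u (s # h))\<^sup>2) \<partial>K (hd h))
        = (\<integral>\<^sup>+s. ennreal (?S\<^sup>2 + 2 * ?S * ?u s + (?u s)\<^sup>2) \<partial>K s0)"
      unfolding square[symmetric] using l by simp
    also have "\<dots> = ennreal (\<integral>s. ?S\<^sup>2 + 2 * ?S * ?u s + (?u s)\<^sup>2 \<partial>K s0)"
    proof (rule nn_integral_eq_integral)
      show "integrable (K s0) (\<lambda>s. ?S\<^sup>2 + 2 * ?S * ?u s + (?u s)\<^sup>2)"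
        using i1 i2 by simp
      show "AE s in K s0. 0 \<le> ?S\<^sup>2 + 2 * ?S * ?u s + (?u s)\<^sup>2"
        by (simp flip: square)
    qed
    also have "(\<integral>s. ?S\<^sup>2 + 2 * ?S * ?u s + (?u s)\<^sup>2 \<partial>K s0) = ?S\<^sup>2 + (\<integral>s. (?u s)\<^sup>2 \<partial>K s0)"
      using i1 i2 mean[of s0 n] by simp
    also have "ennreal \<dots> \<le> ennreal (?S\<^sup>2 + c n)"
      using var[of s0 n] by (intro ennreal_leI) simp
    finally show ?thesis using c[of n] by simp
  qed
  have "(\<integral>\<^sup>+h. ennreal ((transition_sum u h)\<^sup>2) \<partial>history_pmf K x0 (Suc n))
      = (\<integral>\<^sup>+h. (\<integral>\<^sup>+s. ennreal ((transition_sum u (s # h))\<^sup>2) \<partial>K (hd h)) \<partial>history_pmf K x0 n)"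
    by simp
  also have "\<dots> \<le> (\<integral>\<^sup>+h. ennreal ((transition_sum u h)\<^sup>2) + ennreal (c n) \<partial>history_pmf K x0 n)"
    by (rule nn_integral_mono_AE) (auto simp: AE_measure_pmf_iff step)
  also have "\<dots> \<le> ennreal (\<Sum>k<n. c k) + ennreal (c n)"
    using Suc.IH by (subst nn_integral_add) (auto simp: add_right_mono)
  also have "\<dots> = ennreal (\<Sum>k<Suc n. c k)"
    using c by (simp add: sum_nonneg)
  finally show ?case .
qed

text \<open>
  The state space may be uncountable, so the \<sigma>-algebra generated by a history need not contain
  every set of histories. Only events that constrain the history to a countable set are therefore
  used: the support of \<^const>\<open>history_pmf\<close>.
\<close>

locale pmf_chain = prob_space M for M :: "'a measure" +
  fixes X :: "nat \<Rightarrow> 'a \<Rightarrow> 's" and K :: "'s \<Rightarrow> 's pmf" and x0 :: 's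
  assumes X_measurable [measurable]: "X n \<in> measurable M (count_space UNIV)"
    and X_0: "AE \<omega> in M. X 0 \<omega> = x0"
    and X_Suc: "measure M {\<omega> \<in> space M. (\<forall>i\<le>n. X i \<omega> = h i) \<and> X (Suc n) \<omega> = s} =
      measure M {\<omega> \<in> space M. \<forall>i\<le>n. X i \<omega> = h i} * pmf (K (h n)) s"
begin

abbreviation hist :: "nat \<Rightarrow> 'a \<Rightarrow> 's list" where
  "hist n \<omega> \<equiv> history (\<lambda>i. X i \<omega>) n"

lemma sets_hist_eq: "{\<omega> \<in> space M. hist n \<omega> = h} \<in> sets M"
proof (cases "length h = Suc n")
  case True
  then show ?thesis by (simp add: history_eq_iff)
next
  case False
  then have "{\<omega> \<in> space M. hist n \<omega> = h} = {}" by auto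
  then show ?thesis by (simp only: sets.empty_sets)
qed

text \<open>
  The multiplied-out Markov property is exactly the recursion \<open>pmf_history_Suc\<close> of the discrete law.
\<close>

lemma prob_hist_eq: "prob {\<omega> \<in> space M. hist n \<omega> = h} = pmf (history_pmf K x0 n) h"
proof (induction n arbitrary: h)
  case 0
  show ?case
  proof (cases "h = [x0]")
    case True
    have "prob {\<omega> \<in> space M. hist 0 \<omega> = h} = 1"
      using X_0 True sets_hist_eq[of 0 h] by (subst prob_Collect_eq_1) auto
    then show ?thesis using True by simp
  next
    case False
    have "prob {\<omega> \<in> space M. hist 0 \<omega> = h} = 0"
      using X_0 False sets_hist_eq[of 0 h] by (subst prob_Collect_eq_0) auto
    then show ?thesis using False by simp
  qed
next
  case (Suc n)
  show ?case
  proof (cases "length h = Suc (Suc n)")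
    case True
    then obtain s l where h: "h = s # l" and l: "length l = Suc n" by (cases h) auto
    have hd: "hd l = l ! (n - n)" using l by (cases l) auto
    have "{\<omega> \<in> space M. hist (Suc n) \<omega> = h} =
        {\<omega> \<in> space M. (\<forall>i\<le>n. X i \<omega> = l ! (n - i)) \<and> X (Suc n) \<omega> = s}"
      using h l by (auto simp: history_eq_iff)
    then have "prob {\<omega> \<in> space M. hist (Suc n) \<omega> = h} =
        prob {\<omega> \<in> space M. hist n \<omega> = l} * pmf (K (hd l)) s"
      using X_Suc[of n "\<lambda>i. l ! (n - i)" s] l hd by (simp add: history_eq_iff)
    then show ?thesis unfolding Suc.IH h pmf_history_Suc .
  next
    case False
    then have empty: "{\<omega> \<in> space M. hist (Suc n) \<omega> = h} = {}"
      using length_history[of _ "Suc n"] by blast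
    moreover have "pmf (history_pmf K x0 (Suc n)) h = 0"
      using False length_history_pmf[of h K x0 "Suc n"] by (auto simp: pmf_eq_0_set_pmf)
    ultimately show ?thesis by (simp only: empty measure_empty)
  qed
qed

text \<open>
  All probabilities of history events are computed in the discrete law \<^const>\<open>history_pmf\<close> and
  transported to \<open>M\<close> by this lemma; no integral over \<open>M\<close> is taken.
\<close>

lemma
  shows sets_hist: "{\<omega> \<in> space M. hist n \<omega> \<in> A \<inter> set_pmf (history_pmf K x0 n)} \<in> sets M" (is ?S)
    and emeasure_hist: "emeasure M {\<omega> \<in> space M. hist n \<omega> \<in> A \<inter> set_pmf (history_pmf K x0 n)} =
      emeasure (history_pmf K x0 n) A" (is ?E)
proof -
  let ?I = "A \<inter> set_pmf (history_pmf K x0 n)"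
  have un: "{\<omega> \<in> space M. hist n \<omega> \<in> ?I} = (\<Union>h\<in>?I. {\<omega> \<in> space M. hist n \<omega> = h})"
    by auto
  have count: "countable ?I" by (simp add: countable_Int2)
  show ?S unfolding un by (rule sets.countable_UN'[OF count]) (auto simp: sets_hist_eq)
  have "emeasure M {\<omega> \<in> space M. hist n \<omega> \<in> ?I} =
      (\<integral>\<^sup>+h. emeasure M {\<omega> \<in> space M. hist n \<omega> = h} \<partial>count_space ?I)"
    unfolding un by (intro emeasure_UN_countable sets_hist_eq count) (auto simp: disjoint_family_on_def)
  also have "\<dots> = (\<integral>\<^sup>+h. pmf (history_pmf K x0 n) h \<partial>count_space ?I)"
    by (simp add: emeasure_eq_measure prob_hist_eq)
  also have "\<dots> = emeasure (history_pmf K x0 n) ?I" by (rule nn_integral_pmf)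
  also have "\<dots> = emeasure (history_pmf K x0 n) A"
    by (rule emeasure_Int_set_pmf)
  finally show ?E .
qed

lemma AE_hist: "AE \<omega> in M. \<forall>n. hist n \<omega> \<in> set_pmf (history_pmf K x0 n)"
proof (rule AE_all_countable[THEN iffD2], rule allI)
  fix n
  have "emeasure M {\<omega> \<in> space M. hist n \<omega> \<in> UNIV \<inter> set_pmf (history_pmf K x0 n)} = 1"
    unfolding emeasure_hist by (simp add: measure_pmf.emeasure_space_1[simplified])
  then show "AE \<omega> in M. hist n \<omega> \<in> set_pmf (history_pmf K x0 n)"
    using sets_hist[of n UNIV] by (subst (asm) emeasure_eq_measure) (simp add: prob_Collect_eq_1)
qed

lemma AE_transition: "AE \<omega> in M. X 0 \<omega> = x0 \<and> (\<forall>n. X (Suc n) \<omega> \<in> set_pmf (K (X n \<omega>)))"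
  using AE_hist
proof eventually_elim
  case (elim \<omega>)
  have "X (Suc n) \<omega> \<in> set_pmf (K (X n \<omega>))" for n
    using elim[rule_format, of "Suc n"] by auto
  then show ?case using elim[rule_format, of 0] by simp
qed

end

section \<open>A strong law for bounded nonnegative increments\<close>

text \<open>
  The last inequality, variance at most \<open>B\<close> times the mean, is where \<open>0 \<le> f \<le> B\<close> enters through
  \<open>f\<^sup>2 \<le> B * f\<close>. It makes a bound on the conditional means alone sufficient for the strong law.
\<close>

lemma expectation_bounds:
  fixes f :: "'s \<Rightarrow> real" and \<kappa> :: "'s pmf"
  assumes "\<And>t. 0 \<le> f t" "\<And>t. f t \<le> B"
  shows "0 \<le> measure_pmf.expectation \<kappa> f" "measure_pmf.expectation \<kappa> f \<le> B"
    "integrable \<kappa> f"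
    "measure_pmf.expectation \<kappa> (\<lambda>t. f t - measure_pmf.expectation \<kappa> f) = 0"
    "measure_pmf.expectation \<kappa> (\<lambda>t. (f t - measure_pmf.expectation \<kappa> f)\<^sup>2)
      \<le> B * measure_pmf.expectation \<kappa> f"
proof -
  let ?m = "measure_pmf.expectation \<kappa> f"
  show i1: "integrable \<kappa> f"
    using assms by (intro measure_pmf.integrable_const_bound[where B = B]) auto
  have i2: "integrable \<kappa> (\<lambda>t. (f t)\<^sup>2)"
    using assms by (intro measure_pmf.integrable_const_bound[where B = "B\<^sup>2"]) (auto intro!: power_mono)
  show "0 \<le> ?m" using assms by simp
  show "?m \<le> B" using assms i1 by (intro measure_pmf.integral_le_const) auto
  show "measure_pmf.expectation \<kappa> (\<lambda>t. f t - ?m) = 0" using i1 by simp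
  have "measure_pmf.expectation \<kappa> (\<lambda>t. (f t - ?m)\<^sup>2)
      = measure_pmf.expectation \<kappa> (\<lambda>t. (f t)\<^sup>2 - 2 * ?m * f t + ?m\<^sup>2)"
    by (simp add: power2_eq_square algebra_simps)
  also have "\<dots> = measure_pmf.expectation \<kappa> (\<lambda>t. (f t)\<^sup>2) - ?m\<^sup>2"
    using i1 i2 by (simp add: power2_eq_square)
  also have "\<dots> \<le> measure_pmf.expectation \<kappa> (\<lambda>t. (f t)\<^sup>2)" by simp
  also have "\<dots> \<le> measure_pmf.expectation \<kappa> (\<lambda>t. B * f t)"
    using assms i1 i2 by (intro integral_mono) (auto simp: power2_eq_square mult_right_mono)
  finally show "measure_pmf.expectation \<kappa> (\<lambda>t. (f t - ?m)\<^sup>2) \<le> B * ?m" by simp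
qed

lemma chebyshev_pmf:
  fixes \<phi> :: "'s \<Rightarrow> real" and \<kappa> :: "'s pmf"
  assumes "(\<integral>\<^sup>+h. ennreal ((\<phi> h)\<^sup>2) \<partial>\<kappa>) \<le> ennreal v" "0 < e" "0 \<le> v"
  shows "measure \<kappa> {h. e \<le> \<bar>\<phi> h\<bar>} \<le> v / e\<^sup>2"
proof -
  have iff: "1 \<le> ennreal (1 / e\<^sup>2) * ennreal ((\<phi> h)\<^sup>2) \<longleftrightarrow> e \<le> \<bar>\<phi> h\<bar>" for h
  proof -
    have "ennreal (1 / e\<^sup>2) * ennreal ((\<phi> h)\<^sup>2) = ennreal ((\<phi> h)\<^sup>2 / e\<^sup>2)"
      by (simp add: ennreal_mult'[symmetric])
    moreover have "1 \<le> (\<phi> h)\<^sup>2 / e\<^sup>2 \<longleftrightarrow> e \<le> \<bar>\<phi> h\<bar>"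
      using assms(2) by (simp add: le_divide_eq abs_le_square_iff[symmetric])
    ultimately show ?thesis by simp
  qed
  have "emeasure \<kappa> {h \<in> UNIV. 1 \<le> ennreal (1 / e\<^sup>2) * ennreal ((\<phi> h)\<^sup>2)}
      \<le> ennreal (1 / e\<^sup>2) * (\<integral>\<^sup>+h. ennreal ((\<phi> h)\<^sup>2) * indicator UNIV h \<partial>\<kappa>)"
    by (rule nn_integral_Markov_inequality) auto
  then have "emeasure \<kappa> {h. e \<le> \<bar>\<phi> h\<bar>} \<le> ennreal (1 / e\<^sup>2) * (\<integral>\<^sup>+h. ennreal ((\<phi> h)\<^sup>2) \<partial>\<kappa>)"
    by (simp only: iff) simp
  also have "\<dots> \<le> ennreal (1 / e\<^sup>2) * ennreal v"
    using assms(1) by (rule mult_left_mono) simp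
  also have "\<dots> = ennreal (v / e\<^sup>2)"
    by (simp add: ennreal_mult'[symmetric])
  finally show ?thesis
    using assms(3) by (simp add: measure_pmf.emeasure_eq_measure)
qed

context pmf_chain
begin

text \<open>
  The centred increment, switched off at times when the conditional mean exceeds the level \<open>c n\<close>.
  Whether it is switched off is decided by the current state, so this is a martingale difference.
\<close>

definition truncated_martingale ::
    "('s \<Rightarrow> 's \<Rightarrow> real) \<Rightarrow> (nat \<Rightarrow> real) \<Rightarrow> nat \<Rightarrow> 's \<Rightarrow> 's \<Rightarrow> real" where
  "truncated_martingale f c n s t =
     (if measure_pmf.expectation (K s) (f s) \<le> c n
      then f s t - measure_pmf.expectation (K s) (f s) else 0)"

text \<open>
  With the truncation, conditional variances are at most \<open>B * C\<close> times the increments of \<open>b\<close>, so the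
  second moment at time \<open>n\<close> is at most \<open>B * C * b n\<close> and Chebyshev's inequality at scale \<open>b n\<close>
  gives \<open>O(1 / b n)\<close>. This is summable along \<open>sq_time\<close>; Borel--Cantelli yields
  convergence there, and \<open>f \<ge> 0\<close> provides the one-sided control needed to interpolate.
\<close>

lemma truncated_LLN:
  assumes b: "norming b d"
    and f: "\<And>s t. 0 \<le> f s t" "\<And>s t. f s t \<le> B"
    and C: "0 \<le> C"
  defines "u \<equiv> truncated_martingale f (\<lambda>n. C * (b (Suc n) - b n))"
  shows "AE \<omega> in M. (\<lambda>n. transition_sum u (hist n \<omega>) / b n) \<longlonglongrightarrow> 0"
proof -
  interpret norming b d by fact
  let ?g = "\<lambda>s. measure_pmf.expectation (K s) (f s)"
  note E = expectation_bounds[of "f s" B "K s" for s, OF f]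
  have B: "0 \<le> B" using f[of undefined undefined] by linarith
  have d: "0 \<le> d" using b_increment_le[of 0] b_less_Suc[of 0] by linarith
  have u_ge: "u n s t \<ge> - C * (b (Suc n) - b n)" for n s t
    using f(1)[of s t] C b_less_Suc[of n] unfolding u_def truncated_martingale_def
    by (auto simp: mult_nonneg_nonneg less_imp_le)
  have second: "(\<integral>\<^sup>+h. ennreal ((transition_sum u h)\<^sup>2) \<partial>history_pmf K x0 n) \<le> ennreal (B * C * b n)" for n
  proof -
    have "(\<integral>\<^sup>+h. ennreal ((transition_sum u h)\<^sup>2) \<partial>history_pmf K x0 n)
        \<le> ennreal (\<Sum>k<n. B * (C * (b (Suc k) - b k)))"
    proof (rule second_moment_history)
      fix n s t
      show "\<bar>u n s t\<bar> \<le> B"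
        unfolding u_def truncated_martingale_def
        using f[of s t] E(1,2)[of s] B by (auto simp: abs_le_iff)
      show "measure_pmf.expectation (K s) (u n s) = 0"
        using E(4)[of s] unfolding u_def truncated_martingale_def
        by (cases "?g s \<le> C * (b (Suc n) - b n)") simp_all
      show "measure_pmf.expectation (K s) (\<lambda>t. (u n s t)\<^sup>2) \<le> B * (C * (b (Suc n) - b n))"
      proof (cases "?g s \<le> C * (b (Suc n) - b n)")
        case True
        then have "measure_pmf.expectation (K s) (\<lambda>t. (u n s t)\<^sup>2) \<le> B * ?g s"
          using E(5)[of s] by (simp add: u_def truncated_martingale_def)
        also have "\<dots> \<le> B * (C * (b (Suc n) - b n))" using True B by (rule mult_left_mono)
        finally show ?thesis .
      next
        case False
        then show ?thesis
          using B C b_less_Suc[of n] by (simp add: u_def truncated_martingale_def)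
      qed
    qed
    also have "(\<Sum>k<n. B * (C * (b (Suc k) - b k))) = B * C * b n"
      by (simp flip: sum_distrib_left add: sum_lessThan_telescope b_0)
    finally show ?thesis .
  qed
  have small: "AE \<omega> in M. eventually (\<lambda>k. \<bar>transition_sum u (hist (sq_time k) \<omega>)\<bar> < e * (real k)\<^sup>2) sequentially"
    if e: "0 < e" for e
  proof -
    \<comment> \<open>At time \<open>sq_time k\<close> the value of \<open>b\<close> lies between \<open>k\<^sup>2\<close> and \<open>k\<^sup>2 + d\<close>,
      so \<open>k\<^sup>2\<close> takes its place as the scale.\<close>
    define A where "A = (\<lambda>k. {h. e * (real k)\<^sup>2 \<le> \<bar>transition_sum u h\<bar>})"
    define \<Omega> where "\<Omega> = (\<lambda>k. {\<omega> \<in> space M. hist (sq_time k) \<omega> \<in> A k \<inter> set_pmf (history_pmf K x0 (sq_time k))})"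
    have meas: "prob (\<Omega> k) \<le> B * C * (1 + d) / e\<^sup>2 * (1 / (real k)\<^sup>2)" if k: "k \<ge> 1" for k
    proof -
      have "ennreal (prob (\<Omega> k)) = ennreal (measure (history_pmf K x0 (sq_time k)) (A k))"
        unfolding \<Omega>_def
        using emeasure_hist[of "sq_time k" "A k"]
        by (simp only: emeasure_eq_measure measure_pmf.emeasure_eq_measure)
      then have "prob (\<Omega> k) = measure (history_pmf K x0 (sq_time k)) (A k)" by simp
      also have "\<dots> \<le> B * C * b (sq_time k) / (e * (real k)\<^sup>2)\<^sup>2"
        unfolding A_def using e k B C b_nonneg by (intro chebyshev_pmf second) auto
      also have "\<dots> \<le> B * C * ((real k)\<^sup>2 * (1 + d)) / (e * (real k)\<^sup>2)\<^sup>2"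
      proof (intro divide_right_mono mult_left_mono)
        have "1 \<le> (real k)\<^sup>2" using k by simp
        then have "d \<le> (real k)\<^sup>2 * d" using d by (simp add: mult_le_cancel_right1)
        then show "b (sq_time k) \<le> (real k)\<^sup>2 * (1 + d)"
          using sq_time_le[of k] by (simp add: algebra_simps)
      qed (use B C in auto)
      also have "\<dots> = B * C * (1 + d) / e\<^sup>2 * (1 / (real k)\<^sup>2)"
        using k e by (simp add: field_simps power2_eq_square)
      finally show ?thesis .
    qed
    have "summable (\<lambda>k. B * C * (1 + d) / e\<^sup>2 * (1 / (real k)\<^sup>2))"
      by (intro summable_mult inverse_power_summable[of 2, where 'a = real, simplified inverse_eq_divide]) simp
    then have "summable (\<lambda>k. prob (\<Omega> k))"
      by (rule summable_comparison_test'[where N = 1]) (use meas in auto)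
    then have "AE \<omega> in M. eventually (\<lambda>k. \<omega> \<in> space M - \<Omega> k) sequentially"
      by (intro borel_cantelli_AE1) (auto simp only: \<Omega>_def sets_hist emeasure_eq_measure ennreal_less_top infinity_ennreal_def)
    with AE_hist show ?thesis
    proof eventually_elim
      case (elim \<omega>)
      from elim(2) show ?case
        by eventually_elim (use elim(1) in \<open>auto simp: \<Omega>_def A_def not_le\<close>)
    qed
  qed
  have "AE \<omega> in M. \<forall>i. eventually (\<lambda>k. \<bar>transition_sum u (hist (sq_time k) \<omega>)\<bar>
      < 1 / real (Suc i) * (real k)\<^sup>2) sequentially"
    unfolding AE_all_countable by (intro allI small) simp
  then show ?thesis
  proof eventually_elim
    case (elim \<omega>)
    show ?case
    proof (rule interpolation[OF _ _ C])
      show "mono (\<lambda>n. transition_sum u (hist n \<omega>) + C * b n)"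
        unfolding mono_iff_le_Suc
      proof
        fix n
        show "transition_sum u (hist n \<omega>) + C * b n \<le> transition_sum u (hist (Suc n) \<omega>) + C * b (Suc n)"
          using u_ge[of n "X n \<omega>" "X (Suc n) \<omega>"] unfolding transition_sum_history
          by (simp add: algebra_simps)
      qed
      show "(\<lambda>k. transition_sum u (hist (sq_time k) \<omega>) / (real k)\<^sup>2) \<longlonglongrightarrow> 0"
      proof (rule tendstoI)
        fix e :: real assume "0 < e"
        then obtain i where i: "1 / real (Suc i) < e"
          using nat_approx_posE by blast
        show "eventually (\<lambda>k. dist (transition_sum u (hist (sq_time k) \<omega>) / (real k)\<^sup>2) 0 < e) sequentially"
          using elim[rule_format, of i] eventually_gt_at_top[of 0]
        proof eventually_elim
          case (elim k)
          then have "\<bar>transition_sum u (hist (sq_time k) \<omega>)\<bar> / (real k)\<^sup>2 < 1 / real (Suc i)"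
            by (subst pos_divide_less_eq) auto
          with i show ?case by (simp add: abs_divide)
        qed
      qed
    qed
  qed
qed

text \<open>
  Along almost every trajectory the ratio of conditional means to increments of \<open>b\<close> converges, hence
  is bounded by some natural number \<open>i\<close>; at truncation level \<open>i\<close> nothing is switched off on that
  trajectory. Countably many levels suffice, which is why the limit may vary from one trajectory to
  another. The compensator is handled by Stolz--Cesaro.
\<close>

theorem strong_law:
  assumes b: "norming b d"
    and f: "\<And>s t. 0 \<le> f s t" "\<And>s t. f s t \<le> B"
    and lim: "AE \<omega> in M. (\<lambda>n. measure_pmf.expectation (K (X n \<omega>)) (f (X n \<omega>)) / (b (Suc n) - b n))
        \<longlonglongrightarrow> L \<omega>"
  shows "AE \<omega> in M. (\<lambda>n. (\<Sum>k<n. f (X k \<omega>) (X (Suc k) \<omega>)) / b n) \<longlonglongrightarrow> L \<omega>"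
proof -
  interpret norming b d by fact
  let ?g = "\<lambda>s. measure_pmf.expectation (K s) (f s)"
  let ?u = "\<lambda>i::nat. truncated_martingale f (\<lambda>n. real i * (b (Suc n) - b n))"
  have "AE \<omega> in M. \<forall>i. (\<lambda>n. transition_sum (?u i) (hist n \<omega>) / b n) \<longlonglongrightarrow> 0"
    unfolding AE_all_countable by (intro allI truncated_LLN[OF b f]) simp
  with lim show ?thesis
  proof eventually_elim
    case (elim \<omega>)
    let ?a = "\<lambda>n. ?g (X n \<omega>)"
    have "Bseq (\<lambda>n. ?a n / (b (Suc n) - b n))"
      using elim(1) by (intro convergent_imp_Bseq convergentI)
    then obtain C where C: "\<And>n. norm (?a n / (b (Suc n) - b n)) \<le> C"
      unfolding Bseq_def by blast
    obtain i :: nat where i: "C \<le> real i" using real_arch_simple by blast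
    have le: "?a n \<le> real i * (b (Suc n) - b n)" for n
    proof -
      have "?a n / (b (Suc n) - b n) \<le> real i" using order_trans[OF abs_ge_self C[of n, unfolded real_norm_def]] i by linarith
      then show ?thesis using b_less_Suc[of n] by (simp add: divide_le_eq)
    qed
    have "transition_sum (?u i) (hist n \<omega>) = (\<Sum>k<n. f (X k \<omega>) (X (Suc k) \<omega>)) - (\<Sum>k<n. ?a k)" for n
      unfolding transition_sum_history truncated_martingale_def by (simp add: le sum_subtractf)
    then have "(\<lambda>n. (\<Sum>k<n. f (X k \<omega>) (X (Suc k) \<omega>)) / b n - (\<Sum>k<n. ?a k) / b n) \<longlonglongrightarrow> 0"
      using elim(2)[rule_format, of i] by (simp add: diff_divide_distrib)
    from tendsto_add[OF this stolz_cesaro[OF elim(1)]] show ?case by simp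
  qed
qed

end

section \<open>Deterministic properties of the evolving weighted graph\<close>

lemma finite_subsets_of_size: "finite A \<Longrightarrow> finite (subsets_of_size k A)"
  unfolding subsets_of_size_def by simp

lemma card_subsets_of_size: "finite A \<Longrightarrow> card (subsets_of_size k A) = card A choose k"
  unfolding subsets_of_size_def by (rule n_subsets)

lemma subsets_of_size_nonempty: "finite A \<Longrightarrow> k \<le> card A \<Longrightarrow> subsets_of_size k A \<noteq> {}"
  using card_subsets_of_size[of A k] zero_less_binomial[of k "card A"] by auto

text \<open>
  Removing \<open>j\<close> is a bijection onto the subsets of \<open>A - {j}\<close> with one element less.
\<close>

lemma card_subsets_of_size_containing:
  assumes "finite A" "j \<in> A"
  shows "card {B \<in> subsets_of_size (Suc k) A. j \<in> B} = (card A - 1) choose k"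
proof -
  have "bij_betw (insert j) (subsets_of_size k (A - {j})) {B \<in> subsets_of_size (Suc k) A. j \<in> B}"
  proof (rule bij_betwI[where g = "\<lambda>B. B - {j}"])
    show "insert j \<in> subsets_of_size k (A - {j}) \<rightarrow> {B \<in> subsets_of_size (Suc k) A. j \<in> B}"
      using assms unfolding subsets_of_size_def
      by (auto intro!: card_insert_disjoint intro: finite_subset)
    show "(\<lambda>B. B - {j}) \<in> {B \<in> subsets_of_size (Suc k) A. j \<in> B} \<rightarrow> subsets_of_size k (A - {j})"
      unfolding subsets_of_size_def by auto
  qed (auto simp: subsets_of_size_def)
  then have "card {B \<in> subsets_of_size (Suc k) A. j \<in> B} = card (subsets_of_size k (A - {j}))"
    by (rule bij_betw_same_card[symmetric])
  then show ?thesis using assms by (simp add: card_subsets_of_size)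
qed

lemma expectation_uniform_contains:
  assumes "finite A" "j \<in> A" "0 < k" "k \<le> card A"
  shows "measure_pmf.expectation (pmf_of_set (subsets_of_size k A)) (\<lambda>B. of_bool (j \<in> B)) =
    real k / real (card A)"
proof -
  obtain l where k: "k = Suc l" using assms(3) by (cases k) auto
  let ?S = "subsets_of_size k A"
  have S: "finite ?S" "?S \<noteq> {}"
    using assms finite_subsets_of_size subsets_of_size_nonempty by auto
  have "(\<Sum>B\<in>?S. of_bool (j \<in> B) :: real) = real (card {B \<in> ?S. j \<in> B})"
    using S(1) by (simp add: sum.If_cases of_bool_def Int_def Collect_conj_eq[symmetric])
  also have "\<dots> = real ((card A - 1) choose l)"
    unfolding k using assms by (simp add: card_subsets_of_size_containing)
  finally have sum: "(\<Sum>B\<in>?S. of_bool (j \<in> B) :: real) = real ((card A - 1) choose l)" .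
  have "real k * real (card A choose k) = real (card A) * real ((card A - 1) choose l)"
    unfolding k using binomial_absorption[of l "card A"] by (metis of_nat_mult)
  moreover have "card A choose k > 0" using assms by simp
  moreover have "card A > 0" using assms by (auto simp: card_gt_0_iff)
  ultimately have "real ((card A - 1) choose l) / real (card A choose k) = real k / real (card A)"
    by (simp add: frac_eq_eq mult.commute)
  then show ?thesis
    using sum assms by (simp add: integral_pmf_of_set[OF S(2,1)] card_subsets_of_size)
qed

lemma size_filter_mset_eq_sum:
  "size (filter_mset P A) = (\<Sum>x\<in>set_mset A. of_bool (P x) * count A x)"
proof -
  have "size (filter_mset P A) = (\<Sum>x\<in>set_mset (filter_mset P A). count (filter_mset P A) x)"
    by (rule size_multiset_overloaded_eq)
  also have "\<dots> = (\<Sum>x\<in>set_mset A. of_bool (P x) * count A x)"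
    by (rule sum.mono_neutral_cong_left) auto
  finally show ?thesis .
qed

lemma expectation_pmf_of_multiset_of_bool:
  assumes "A \<noteq> {#}"
  shows "measure_pmf.expectation (pmf_of_multiset A) (\<lambda>x. of_bool (P x)) =
    real (size (filter_mset P A)) / real (size A)"
proof -
  have "measure_pmf.expectation (pmf_of_multiset A) (\<lambda>x. of_bool (P x)) =
      (\<Sum>x\<in>set_mset A. of_bool (P x) * (real (count A x) / real (size A)))"
    using assms by (subst integral_measure_pmf_real[of "set_mset A"]) auto
  also have "\<dots> = (\<Sum>x\<in>set_mset A. of_bool (P x) * real (count A x)) / real (size A)"
    by (simp only: sum_divide_distrib times_divide_eq_right)
  also have "(\<Sum>x\<in>set_mset A. of_bool (P x) * real (count A x)) = real (size (filter_mset P A))"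
    unfolding size_filter_mset_eq_sum by simp
  finally show ?thesis .
qed

lemma vertex_weight_eq_size: "vertex_weight s j = size {#T \<in># triangle_weights s. j \<in> T#}"
  unfolding vertex_weight_def size_filter_mset_eq_sum
  by (rule sum.mono_neutral_cong_left) auto

definition neighbours :: "graph_state \<Rightarrow> int \<Rightarrow> int set" where
  "neighbours s j = {i. i \<noteq> j \<and> {i, j} \<in> edges s}"

lemma vertex_degree_eq: "vertex_degree s j = card (neighbours s j)"
  by (simp add: vertex_degree_def neighbours_def)

text \<open>
  The invariant of the process after \<open>n\<close> steps. Each interaction adds one triangle and its three
  edges, of which two contain a given vertex of the triangle; this yields the total weights \<open>n + 1\<close>
  and \<open>3 * (n + 1)\<close>, and the factor 2 between the edge weights at a vertex and its weight. Edges of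
  positive weight and sides of triangles of positive weight belong to the graph, so old vertices
  that are selected by weight are already joined to each other.
\<close>

definition valid_state :: "nat \<Rightarrow> graph_state \<Rightarrow> bool" where
  "valid_state n s \<longleftrightarrow>
     finite (vertices s) \<and> 3 \<le> card (vertices s) \<and>
     edges s \<subseteq> subsets_of_size 2 (vertices s) \<and>
     size (edge_weights s) = 3 * Suc n \<and> set_mset (edge_weights s) \<subseteq> edges s \<and>
     size (triangle_weights s) = Suc n \<and>
     (\<forall>T\<in>#triangle_weights s. T \<in> subsets_of_size 3 (vertices s) \<and> subsets_of_size 2 T \<subseteq> edges s) \<and>
     (\<forall>j. size {#e \<in># edge_weights s. j \<in> e#} = 2 * vertex_weight s j)"

lemma valid_stateD:
  assumes "valid_state n s"
  shows "finite (vertices s)" "3 \<le> card (vertices s)" "edges s \<subseteq> subsets_of_size 2 (vertices s)"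
    "size (edge_weights s) = 3 * Suc n" "set_mset (edge_weights s) \<subseteq> edges s"
    "size (triangle_weights s) = Suc n"
    "\<And>T. T \<in># triangle_weights s \<Longrightarrow> T \<in> subsets_of_size 3 (vertices s)"
    "\<And>T. T \<in># triangle_weights s \<Longrightarrow> subsets_of_size 2 T \<subseteq> edges s"
    "size {#e \<in># edge_weights s. j \<in> e#} = 2 * vertex_weight s j"
    "edge_weights s \<noteq> {#}" "triangle_weights s \<noteq> {#}"
  using assms unfolding valid_state_def by auto

lemma new_vertex_notin: "valid_state n s \<Longrightarrow> new_vertex s \<notin> vertices s"
  using Max_ge[of "vertices s" "new_vertex s"] by (auto simp: valid_state_def new_vertex_def)

lemma valid_initial_state: "valid_state 0 initial_state"
proof -
  have edges: "subsets_of_size 2 {-2, -1, 0} \<subseteq> {{-2, -1}, {-2, 0}, {-1, 0}}"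
  proof
    fix B assume "B \<in> subsets_of_size 2 {-2, -1, 0}"
    then obtain x y where "B = {x, y}" "x \<noteq> y" "x \<in> {-2, -1, 0}" "y \<in> {-2, -1, 0}"
      by (auto simp: subsets_of_size_def card_2_iff)
    then show "B \<in> {{-2, -1}, {-2, 0}, {-1, 0}}" by (elim insertE emptyE) (simp_all add: insert_commute)
  qed
  have "size {#e \<in># edge_weights initial_state. j \<in> e#} = 2 * vertex_weight initial_state j" for j
    unfolding vertex_weight_eq_size by (simp add: initial_state_def)
  then show ?thesis
    using edges unfolding valid_state_def by (simp add: initial_state_def subsets_of_size_def)
qed

lemma finite_set_pmf_interacting:
  assumes "valid_state n s"
  shows "finite (set_pmf (pmf_of_multiset (edge_weights s)))"
    "finite (set_pmf (pmf_of_multiset (triangle_weights s)))"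
    "finite (set_pmf (pmf_of_set (subsets_of_size 2 (vertices s))))"
    "finite (set_pmf (pmf_of_set (subsets_of_size 3 (vertices s))))"
    "set_pmf (pmf_of_set (subsets_of_size 2 (vertices s))) = subsets_of_size 2 (vertices s)"
    "set_pmf (pmf_of_set (subsets_of_size 3 (vertices s))) = subsets_of_size 3 (vertices s)"
proof -
  note D = valid_stateD[OF assms]
  have "subsets_of_size 2 (vertices s) \<noteq> {}" "subsets_of_size 3 (vertices s) \<noteq> {}"
    using D(1,2) by (simp_all add: subsets_of_size_nonempty)
  then show "set_pmf (pmf_of_set (subsets_of_size 2 (vertices s))) = subsets_of_size 2 (vertices s)"
    "set_pmf (pmf_of_set (subsets_of_size 3 (vertices s))) = subsets_of_size 3 (vertices s)"
    using D(1) by (simp_all add: finite_subsets_of_size)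
  then show "finite (set_pmf (pmf_of_set (subsets_of_size 2 (vertices s))))"
    "finite (set_pmf (pmf_of_set (subsets_of_size 3 (vertices s))))"
    using D(1) by (simp_all add: finite_subsets_of_size)
  show "finite (set_pmf (pmf_of_multiset (edge_weights s)))"
    "finite (set_pmf (pmf_of_multiset (triangle_weights s)))"
    using D(10,11) by simp_all
qed

lemma interacting_triple_cases:
  assumes v: "valid_state n s" and T: "T \<in> set_pmf (interacting_triple p q r s)"
  obtains e where "e \<in> subsets_of_size 2 (vertices s)" "T = insert (new_vertex s) e"
  | "T \<in> subsets_of_size 3 (vertices s)"
proof -
  note D = valid_stateD[OF v] and S = finite_set_pmf_interacting[OF v]
  have "set_pmf (pmf_of_multiset (edge_weights s)) \<subseteq> subsets_of_size 2 (vertices s)"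
    "set_pmf (pmf_of_multiset (triangle_weights s)) \<subseteq> subsets_of_size 3 (vertices s)"
    using D(3,5) D(7) by (auto simp: set_pmf_of_multiset[OF D(10)] set_pmf_of_multiset[OF D(11)])
  moreover have "(\<exists>e. T = insert (new_vertex s) e \<and> (e \<in> set_pmf (pmf_of_multiset (edge_weights s))
        \<or> e \<in> set_pmf (pmf_of_set (subsets_of_size 2 (vertices s)))))
      \<or> T \<in> set_pmf (pmf_of_multiset (triangle_weights s))
      \<or> T \<in> set_pmf (pmf_of_set (subsets_of_size 3 (vertices s)))"
    using T unfolding interacting_triple_def set_bind_pmf
    by (auto split: if_splits)
  ultimately show ?thesis using that unfolding S(5,6) by blast
qed

lemma card_insert_new_vertex:
  assumes "valid_state n s" "e \<in> subsets_of_size 2 (vertices s)"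
  shows "card (insert (new_vertex s) e) = 3"
proof -
  have "finite e" "new_vertex s \<notin> e"
    using assms valid_stateD(1)[OF assms(1)] new_vertex_notin[OF assms(1)]
    by (auto simp: subsets_of_size_def intro: finite_subset)
  then show ?thesis using assms(2) by (simp add: subsets_of_size_def)
qed

lemma card_interacting_triple:
  assumes v: "valid_state n s" and T: "T \<in> set_pmf (interacting_triple p q r s)"
  shows "card T = 3"
  using v T
proof (cases rule: interacting_triple_cases)
  case (1 e)
  then show ?thesis using card_insert_new_vertex[OF v] by simp
qed (simp add: subsets_of_size_def)

lemma vertex_weight_interact: "vertex_weight (interact s T) j = vertex_weight s j + of_bool (j \<in> T)"
  by (simp add: vertex_weight_eq_size interact_def)

lemma valid_interact:
  assumes v: "valid_state n s" and T: "card T = 3"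
  shows "valid_state (Suc n) (interact s T)"
proof -
  note D = valid_stateD[OF v]
  have T3: "card T = 3" "finite T" using T by (simp_all add: card_ge_0_finite)
  let ?E = "subsets_of_size 2 T"
  have E: "finite ?E" "card ?E = 3"
    using T3 by (simp_all add: finite_subsets_of_size card_subsets_of_size choose_two)
  have deg: "card {e \<in> ?E. j \<in> e} = 2 * of_bool (j \<in> T)" for j
  proof (cases "j \<in> T")
    case True
    then show ?thesis
      using card_subsets_of_size_containing[OF T3(2) True, of 1, unfolded Suc_1] T3 by simp
  next
    case False
    then have empty: "{e \<in> ?E. j \<in> e} = {}" by (auto simp: subsets_of_size_def)
    show ?thesis using False by (simp add: empty del: Collect_empty_eq)
  qed
  have "card (vertices s) \<le> card (vertices s \<union> T)"
    using D(1) T3 by (intro card_mono) auto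
  then have V: "finite (vertices s \<union> T)" "3 \<le> card (vertices s \<union> T)"
    using D(1,2) T3 by auto
  have "\<forall>j. size {#e \<in># edge_weights (interact s T). j \<in> e#} = 2 * vertex_weight (interact s T) j"
    unfolding vertex_weight_interact using E deg by (simp add: interact_def D(9) filter_mset_mset_set)
  moreover have "size (edge_weights (interact s T)) = 3 * Suc (Suc n)"
    "size (triangle_weights (interact s T)) = Suc (Suc n)"
    using D(4,6) E by (simp_all add: interact_def)
  moreover have "edges (interact s T) \<subseteq> subsets_of_size 2 (vertices (interact s T))"
    using D(3) by (auto simp: interact_def subsets_of_size_def)
  moreover have "set_mset (edge_weights (interact s T)) \<subseteq> edges (interact s T)"
    using D(5) E by (auto simp: interact_def)
  moreover have "\<forall>T'\<in>#triangle_weights (interact s T). T' \<in> subsets_of_size 3 (vertices (interact s T))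
      \<and> subsets_of_size 2 T' \<subseteq> edges (interact s T)"
  proof
    fix T' assume "T' \<in># triangle_weights (interact s T)"
    then consider "T' = T" | "T' \<in># triangle_weights s" by (auto simp: interact_def)
    then show "T' \<in> subsets_of_size 3 (vertices (interact s T)) \<and> subsets_of_size 2 T' \<subseteq> edges (interact s T)"
    proof cases
      case 1
      then show ?thesis using T3 by (simp add: interact_def subsets_of_size_def)
    next
      case 2
      from D(7)[OF 2] have "T' \<subseteq> vertices s \<union> T" "card T' = 3" by (auto simp: subsets_of_size_def)
      moreover from D(8)[OF 2] have "subsets_of_size 2 T' \<subseteq> edges s \<union> ?E" by blast
      ultimately show ?thesis by (simp add: interact_def) (simp add: subsets_of_size_def)
    qed
  qed
  ultimately show ?thesis
    using V unfolding valid_state_def by (simp add: interact_def)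
qed

lemma finite_neighbours: "valid_state n s \<Longrightarrow> finite (neighbours s j)"
  by (rule finite_subset[of _ "vertices s"])
     (auto simp: neighbours_def valid_state_def subsets_of_size_def)

lemma neighbours_interact:
  "neighbours (interact s T) j = neighbours s j \<union> (if j \<in> T then T - {j} else {})"
  by (auto simp: neighbours_def interact_def subsets_of_size_def)

lemma vertex_degree_interact_bounds:
  assumes v: "valid_state n s" and T: "card T = 3"
  shows "vertex_degree s j \<le> vertex_degree (interact s T) j"
    "vertex_degree (interact s T) j \<le> vertex_degree s j + 2 * of_bool (j \<in> T)"
proof -
  have T3: "card T = 3" "finite T" using T by (simp_all add: card_ge_0_finite)
  let ?A = "if j \<in> T then T - {j} else {}"
  have A: "finite ?A" "card ?A = 2 * of_bool (j \<in> T)" using T3 by auto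
  show "vertex_degree s j \<le> vertex_degree (interact s T) j"
    unfolding vertex_degree_eq neighbours_interact
    using A(1) finite_neighbours[OF v] by (intro card_mono) auto
  show "vertex_degree (interact s T) j \<le> vertex_degree s j + 2 * of_bool (j \<in> T)"
    unfolding vertex_degree_eq neighbours_interact
    using card_Un_le[of "neighbours s j" ?A] A(2) by linarith
qed

text \<open>
  When a new vertex attaches to an existing edge, an endpoint of the edge gains the new vertex but
  not the other endpoint, which is a neighbour already.
\<close>

lemma vertex_degree_interact_edge:
  assumes v: "valid_state n s" and e: "e \<in> edges s" and j: "j \<in> vertices s"
  shows "vertex_degree (interact s (insert (new_vertex s) e)) j = vertex_degree s j + of_bool (j \<in> e)"
proof (cases "j \<in> e")
  case True
  note D = valid_stateD[OF v]
  let ?v = "new_vertex s"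
  have new: "?v \<notin> vertices s" by (rule new_vertex_notin[OF v])
  have "card e = 2" "e \<subseteq> vertices s" using e D(3) by (auto simp: subsets_of_size_def)
  with True obtain i where i: "e = {i, j}" "i \<noteq> j" by (auto simp: card_2_iff)
  have "neighbours (interact s (insert ?v e)) j = insert ?v (neighbours s j)"
    using i e j new by (auto simp: neighbours_interact) (auto simp: neighbours_def)
  moreover have "?v \<notin> neighbours s j"
    using new D(3) by (auto simp: neighbours_def subsets_of_size_def)
  ultimately show ?thesis
    using True finite_neighbours[OF v] by (simp add: vertex_degree_eq)
next
  case False
  then have "j \<notin> insert (new_vertex s) e" using j new_vertex_notin[OF v] by auto
  then show ?thesis using False by (simp add: vertex_degree_eq neighbours_interact)
qed

lemma vertex_degree_interact_triangle:
  assumes v: "valid_state n s" and T: "T \<in># triangle_weights s"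
  shows "vertex_degree (interact s T) j = vertex_degree s j"
proof -
  have "edges (interact s T) = edges s"
    using valid_stateD(8)[OF v T] by (auto simp: interact_def)
  then show ?thesis by (simp add: vertex_degree_def)
qed

lemma expectation_bernoulli_bind:
  fixes h :: "'s \<Rightarrow> real"
  assumes "0 \<le> p" "p \<le> 1" "\<And>x. finite (set_pmf (\<kappa> x))"
  shows "measure_pmf.expectation (bind_pmf (bernoulli_pmf p) \<kappa>) h =
    p * measure_pmf.expectation (\<kappa> True) h + (1 - p) * measure_pmf.expectation (\<kappa> False) h"
  using assms by (subst pmf_expectation_bind[of UNIV]) (auto simp: UNIV_bool)

lemma expectation_interacting_triple:
  fixes h :: "int set \<Rightarrow> real"
  assumes v: "valid_state n s"
    and "0 \<le> p" "p \<le> 1" "0 \<le> q" "q \<le> 1" "0 \<le> r" "r \<le> 1"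
  defines "new \<equiv> insert (new_vertex s)"
  shows "measure_pmf.expectation (interacting_triple p q r s) h =
    p * (r * measure_pmf.expectation (pmf_of_multiset (edge_weights s)) (\<lambda>e. h (new e)) +
         (1 - r) * measure_pmf.expectation (pmf_of_set (subsets_of_size 2 (vertices s))) (\<lambda>e. h (new e))) +
    (1 - p) * (q * measure_pmf.expectation (pmf_of_multiset (triangle_weights s)) h +
         (1 - q) * measure_pmf.expectation (pmf_of_set (subsets_of_size 3 (vertices s))) h)"
  unfolding interacting_triple_def new_def
  using assms finite_set_pmf_interacting(1-4)[OF v]
  by (simp add: expectation_bernoulli_bind)

section \<open>Expected one-step gains\<close>

text \<open>
  The increment of a statistic, truncated into the interval from 0 to \<open>c\<close> so that it is bounded on
  all pairs of states, as the strong law requires; on actual transitions it is the true increment.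
\<close>

definition capped_gain :: "nat \<Rightarrow> ('s \<Rightarrow> nat) \<Rightarrow> 's \<Rightarrow> 's \<Rightarrow> real" where
  "capped_gain c \<phi> s t = real (min c (\<phi> t - \<phi> s))"

lemma sum_capped_gain:
  assumes "\<And>k. \<phi> (x k) \<le> \<phi> (x (Suc k))" "\<And>k. \<phi> (x (Suc k)) \<le> \<phi> (x k) + c"
  shows "(\<Sum>k<n. capped_gain c \<phi> (x k) (x (Suc k))) = real (\<phi> (x n)) - real (\<phi> (x 0))"
proof -
  have "capped_gain c \<phi> (x k) (x (Suc k)) = real (\<phi> (x (Suc k))) - real (\<phi> (x k))" for k
    using assms[of k] by (simp add: capped_gain_def)
  then show ?thesis by (simp add: sum_lessThan_telescope[of "\<lambda>k. real (\<phi> (x k))"])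
qed

text \<open>
  For a statistic of the state whose increments lie between 0 and \<open>c\<close>, the sums in the strong law
  telescope. The number of vertices, the weight and the degree of a vertex are all of this kind.
\<close>

lemma (in pmf_chain) statistic_growth:
  fixes \<phi> :: "'s \<Rightarrow> nat"
  assumes b: "norming b d"
    and inc: "AE \<omega> in M. \<forall>k. \<phi> (X k \<omega>) \<le> \<phi> (X (Suc k) \<omega>) \<and> \<phi> (X (Suc k) \<omega>) \<le> \<phi> (X k \<omega>) + c"
    and lim: "AE \<omega> in M. (\<lambda>n. measure_pmf.expectation (K (X n \<omega>)) (capped_gain c \<phi> (X n \<omega>))
        / (b (Suc n) - b n)) \<longlonglongrightarrow> L \<omega>"
  shows "AE \<omega> in M. (\<lambda>n. real (\<phi> (X n \<omega>)) / b n) \<longlonglongrightarrow> L \<omega>"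
proof -
  interpret norming b d by fact
  have "AE \<omega> in M. (\<lambda>n. (\<Sum>k<n. capped_gain c \<phi> (X k \<omega>) (X (Suc k) \<omega>)) / b n) \<longlonglongrightarrow> L \<omega>"
    by (rule strong_law[OF b _ _ lim, where B = "real c"]) (simp_all add: capped_gain_def)
  with inc show ?thesis
  proof eventually_elim
    case (elim \<omega>)
    have const: "(\<lambda>n. real (\<phi> (X 0 \<omega>)) / b n) \<longlonglongrightarrow> 0"
      by (intro tendsto_divide_0[OF tendsto_const] filterlim_at_top_imp_at_infinity b_at_top)
    have "(\<Sum>k<n. capped_gain c \<phi> (X k \<omega>) (X (Suc k) \<omega>)) = real (\<phi> (X n \<omega>)) - real (\<phi> (X 0 \<omega>))" for n
      using elim(1) by (intro sum_capped_gain[where x = "\<lambda>i. X i \<omega>"]) auto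
    then have "(\<lambda>n. real (\<phi> (X n \<omega>)) / b n - real (\<phi> (X 0 \<omega>)) / b n) \<longlonglongrightarrow> L \<omega>"
      using elim(2) by (simp add: diff_divide_distrib)
    from tendsto_add[OF this const] show ?case by simp
  qed
qed

lemma expectation_cong_pmf:
  fixes f g :: "'s \<Rightarrow> real"
  assumes "\<And>x. x \<in> set_pmf \<kappa> \<Longrightarrow> f x = g x"
  shows "measure_pmf.expectation \<kappa> f = measure_pmf.expectation \<kappa> g"
  using assms by (intro integral_cong_AE) (auto simp: AE_measure_pmf_iff)

lemma expectation_mono_pmf:
  fixes f g :: "'s \<Rightarrow> real"
  assumes "\<And>x. x \<in> set_pmf \<kappa> \<Longrightarrow> f x \<le> g x" "finite (set_pmf \<kappa>)"
  shows "measure_pmf.expectation \<kappa> f \<le> measure_pmf.expectation \<kappa> g"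
  using assms by (intro integral_mono_AE) (auto simp: AE_measure_pmf_iff integrable_measure_pmf_finite)

context
  fixes p q r :: real and n :: nat and s :: graph_state and j :: int
  assumes v: "valid_state n s"
    and pqr: "0 \<le> p" "p \<le> 1" "0 \<le> q" "q \<le> 1" "0 \<le> r" "r \<le> 1"
begin

private abbreviation "new \<equiv> insert (new_vertex s)"
private abbreviation "gain c \<phi> T \<equiv> capped_gain c \<phi> s (interact s T)"

lemma interaction_support:
  "e \<in> set_pmf (pmf_of_multiset (edge_weights s)) \<Longrightarrow> e \<in> edges s \<and> e \<in> subsets_of_size 2 (vertices s)"
  "e \<in> set_pmf (pmf_of_set (subsets_of_size 2 (vertices s))) \<Longrightarrow> e \<in> subsets_of_size 2 (vertices s)"
  "T \<in> set_pmf (pmf_of_multiset (triangle_weights s)) \<Longrightarrow> T \<in># triangle_weights s \<and> T \<in> subsets_of_size 3 (vertices s)"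
  "T \<in> set_pmf (pmf_of_set (subsets_of_size 3 (vertices s))) \<Longrightarrow> T \<in> subsets_of_size 3 (vertices s)"
  using valid_stateD(3,5)[OF v] valid_stateD(7)[OF v] finite_set_pmf_interacting[OF v]
  by (auto simp: set_pmf_of_multiset[OF valid_stateD(10)[OF v]] set_pmf_of_multiset[OF valid_stateD(11)[OF v]])

lemma expectation_step:
  "measure_pmf.expectation (step p q r s) (capped_gain c \<phi> s) =
    p * (r * measure_pmf.expectation (pmf_of_multiset (edge_weights s)) (\<lambda>e. gain c \<phi> (new e)) +
         (1 - r) * measure_pmf.expectation (pmf_of_set (subsets_of_size 2 (vertices s))) (\<lambda>e. gain c \<phi> (new e))) +
    (1 - p) * (q * measure_pmf.expectation (pmf_of_multiset (triangle_weights s)) (gain c \<phi>) +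
         (1 - q) * measure_pmf.expectation (pmf_of_set (subsets_of_size 3 (vertices s))) (gain c \<phi>))"
  unfolding step_def by (simp add: expectation_interacting_triple[OF v pqr])

text \<open>
  The total weights \<open>3 * (n + 1)\<close> of the edges and \<open>n + 1\<close> of the triangles are known from the
  invariant, and so is the share of \<open>j\<close> in them; this makes preferential choices linear in the weight
  of \<open>j\<close>. The uniform choices contain \<open>j\<close> by symmetry with probability \<open>2\<close> or \<open>3\<close> over the number of
  vertices.
\<close>

lemma expectation_contains:
  assumes j: "j \<in> vertices s"
  shows
    "measure_pmf.expectation (pmf_of_multiset (edge_weights s)) (\<lambda>e. of_bool (j \<in> e)) =
      2 / 3 * (real (vertex_weight s j) / real (Suc n))"
    "measure_pmf.expectation (pmf_of_set (subsets_of_size 2 (vertices s))) (\<lambda>e. of_bool (j \<in> e)) =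
      2 / real (card (vertices s))"
    "measure_pmf.expectation (pmf_of_multiset (triangle_weights s)) (\<lambda>T. of_bool (j \<in> T)) =
      real (vertex_weight s j) / real (Suc n)"
    "measure_pmf.expectation (pmf_of_set (subsets_of_size 3 (vertices s))) (\<lambda>T. of_bool (j \<in> T)) =
      3 / real (card (vertices s))"
proof -
  note D = valid_stateD[OF v]
  show "measure_pmf.expectation (pmf_of_multiset (edge_weights s)) (\<lambda>e. of_bool (j \<in> e)) =
      2 / 3 * (real (vertex_weight s j) / real (Suc n))"
    unfolding expectation_pmf_of_multiset_of_bool[OF D(10)] D(4) D(9) by simp
  show "measure_pmf.expectation (pmf_of_multiset (triangle_weights s)) (\<lambda>T. of_bool (j \<in> T)) =
      real (vertex_weight s j) / real (Suc n)"
    unfolding expectation_pmf_of_multiset_of_bool[OF D(11)] D(6) vertex_weight_eq_size by simp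
qed (use expectation_uniform_contains[OF valid_stateD(1)[OF v] j] valid_stateD(2)[OF v] in auto)

lemma expected_new_vertices:
  "measure_pmf.expectation (step p q r s) (capped_gain 1 (\<lambda>s. card (vertices s)) s) = p"
proof -
  let ?g = "gain 1 (\<lambda>s. card (vertices s))"
  have one: "?g (new e) = 1" if "e \<in> subsets_of_size 2 (vertices s)" for e
  proof -
    have "vertices s \<union> new e = new (vertices s)" using that by (auto simp: subsets_of_size_def)
    then show ?thesis
      using valid_stateD(1)[OF v] new_vertex_notin[OF v] by (simp add: capped_gain_def interact_def)
  qed
  have zero: "?g T = 0" if "T \<in> subsets_of_size 3 (vertices s)" for T
    using that by (simp add: capped_gain_def interact_def subsets_of_size_def Un_absorb2)
  have
    "measure_pmf.expectation (pmf_of_multiset (edge_weights s)) (\<lambda>e. ?g (new e)) = measure_pmf.expectation (pmf_of_multiset (edge_weights s)) (\<lambda>e. 1)"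
    "measure_pmf.expectation (pmf_of_set (subsets_of_size 2 (vertices s))) (\<lambda>e. ?g (new e)) = measure_pmf.expectation (pmf_of_set (subsets_of_size 2 (vertices s))) (\<lambda>e. 1)"
    "measure_pmf.expectation (pmf_of_multiset (triangle_weights s)) ?g = measure_pmf.expectation (pmf_of_multiset (triangle_weights s)) (\<lambda>T. 0)"
    "measure_pmf.expectation (pmf_of_set (subsets_of_size 3 (vertices s))) ?g = measure_pmf.expectation (pmf_of_set (subsets_of_size 3 (vertices s))) (\<lambda>T. 0)"
    by (rule expectation_cong_pmf, blast intro: one zero dest: interaction_support)+
  then show ?thesis by (simp add: expectation_step)
qed

text \<open>
  The two terms are the selection of \<open>j\<close> by weight and at random. A step adds at most one triangle at \<open>j\<close>,
  so the expected gain is the probability that \<open>j\<close> is selected.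
\<close>

lemma expected_weight_gain:
  assumes j: "j \<in> vertices s"
  shows "measure_pmf.expectation (step p q r s) (capped_gain 1 (\<lambda>s. vertex_weight s j) s) =
    alpha p q r * (real (vertex_weight s j) / real (Suc n))
      + (2 * p * (1 - r) + 3 * (1 - p) * (1 - q)) / real (card (vertices s))"
proof -
  have g: "gain 1 (\<lambda>s. vertex_weight s j) T = of_bool (j \<in> T)" for T
    by (simp add: capped_gain_def vertex_weight_interact)
  have regroup: "p * (r * (2 / 3 * x) + (1 - r) * (2 / y)) + (1 - p) * (q * x + (1 - q) * (3 / y)) =
      ((1 - p) * q + 2 * p * r / 3) * x + (2 * p * (1 - r) + 3 * (1 - p) * (1 - q)) / y" for x y :: real
  proof -
    define z where "z = 1 / y"
    have "2 / y = 2 * z" "3 / y = 3 * z" "c / y = c * z" for c by (simp_all add: z_def)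
    then show ?thesis by (simp only:) (simp add: algebra_simps)
  qed
  have "j \<noteq> new_vertex s" using j new_vertex_notin[OF v] by auto
  then have "measure_pmf.expectation (step p q r s) (capped_gain 1 (\<lambda>s. vertex_weight s j) s) =
      p * (r * (2 / 3 * (real (vertex_weight s j) / real (Suc n))) + (1 - r) * (2 / real (card (vertices s)))) +
      (1 - p) * (q * (real (vertex_weight s j) / real (Suc n)) + (1 - q) * (3 / real (card (vertices s))))"
    unfolding expectation_step g by (simp only: insert_iff simp_thms expectation_contains[OF j])
  also have "\<dots> = alpha p q r * (real (vertex_weight s j) / real (Suc n))
      + (2 * p * (1 - r) + 3 * (1 - p) * (1 - q)) / real (card (vertices s))"
    unfolding alpha_def alpha1_def alpha2_def
    by (rule regroup)
  finally show ?thesis .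
qed

text \<open>
  The heart of the matter: weight-driven selection raises the degree of \<open>j\<close> only when a new vertex
  arrives, and then by exactly 1, which gives the term with \<^const>\<open>alpha2\<close>; a weighted triangle has
  all its sides drawn already, so the \<^const>\<open>alpha1\<close> part of the weight growth is lost. Uniform selection
  finds \<open>j\<close> with probability at most 3 over the number of vertices and adds at most 2; with
  2 vertices instead of 3 in the first case this makes at most \<open>2 * 2 + 2 * 3 = 10\<close>.
\<close>

lemma expected_degree_gain:
  assumes j: "j \<in> vertices s"
  defines "g \<equiv> measure_pmf.expectation (step p q r s) (capped_gain 2 (\<lambda>s. vertex_degree s j) s)"
  shows "alpha2 p r * (real (vertex_weight s j) / real (Suc n)) \<le> g"
    "g \<le> alpha2 p r * (real (vertex_weight s j) / real (Suc n)) + 10 / real (card (vertices s))"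
proof -
  let ?g = "gain 2 (\<lambda>s. vertex_degree s j)"
  let ?w = "real (vertex_weight s j) / real (Suc n)" and ?V = "real (card (vertices s))"
  let ?E = "measure_pmf.expectation (pmf_of_multiset (edge_weights s)) (\<lambda>e. ?g (new e))"
    and ?P = "measure_pmf.expectation (pmf_of_set (subsets_of_size 2 (vertices s))) (\<lambda>e. ?g (new e))"
    and ?T = "measure_pmf.expectation (pmf_of_multiset (triangle_weights s)) ?g"
    and ?U = "measure_pmf.expectation (pmf_of_set (subsets_of_size 3 (vertices s))) ?g"
  note fin = finite_set_pmf_interacting[OF v]
  have jv: "j \<noteq> new_vertex s" using j new_vertex_notin[OF v] by auto
  have nonneg: "0 \<le> ?g T" for T by (simp add: capped_gain_def)
  have le: "?g T \<le> 2 * of_bool (j \<in> T)" if "card T = 3" for T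
    using vertex_degree_interact_bounds(2)[OF v that, of j] by (auto simp: capped_gain_def split: if_splits)
  have "?E = measure_pmf.expectation (pmf_of_multiset (edge_weights s)) (\<lambda>e. of_bool (j \<in> e))"
    by (rule expectation_cong_pmf)
       (auto dest!: interaction_support(1) simp: capped_gain_def vertex_degree_interact_edge[OF v _ j])
  then have E: "?E = 2 / 3 * ?w" by (simp only: expectation_contains[OF j])
  have "?P \<le> measure_pmf.expectation (pmf_of_set (subsets_of_size 2 (vertices s))) (\<lambda>e. 2 * of_bool (j \<in> e))"
  proof (rule expectation_mono_pmf[OF _ fin(3)])
    fix e assume "e \<in> set_pmf (pmf_of_set (subsets_of_size 2 (vertices s)))"
    then show "?g (new e) \<le> 2 * of_bool (j \<in> e)"
      using le[OF card_insert_new_vertex[OF v interaction_support(2)]] jv by simp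
  qed
  then have P: "?P \<le> 4 / ?V" by (simp add: expectation_contains[OF j])
  have "?T = measure_pmf.expectation (pmf_of_multiset (triangle_weights s)) (\<lambda>e. 0)"
  proof (rule expectation_cong_pmf)
    fix T assume "T \<in> set_pmf (pmf_of_multiset (triangle_weights s))"
    then show "?g T = 0"
      using vertex_degree_interact_triangle[OF v] interaction_support(3) by (simp add: capped_gain_def)
  qed
  then have T: "?T = 0" by simp
  have "?U \<le> measure_pmf.expectation (pmf_of_set (subsets_of_size 3 (vertices s))) (\<lambda>e. 2 * of_bool (j \<in> e))"
  proof (rule expectation_mono_pmf[OF _ fin(4)])
    fix T assume "T \<in> set_pmf (pmf_of_set (subsets_of_size 3 (vertices s)))"
    then have "T \<in> subsets_of_size 3 (vertices s)" by (rule interaction_support(4))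
    then have "card T = 3" by (simp add: subsets_of_size_def)
    then show "?g T \<le> 2 * of_bool (j \<in> T)" by (rule le)
  qed
  then have U: "?U \<le> 6 / ?V" by (simp add: expectation_contains[OF j])
  have P0: "0 \<le> ?P" and U0: "0 \<le> ?U" using nonneg by simp_all
  have g: "g = alpha2 p r * ?w + (p * (1 - r) * ?P + (1 - p) * (1 - q) * ?U)"
    unfolding g_def expectation_step E T alpha2_def by (simp add: algebra_simps)
  show "alpha2 p r * ?w \<le> g"
    unfolding g using pqr P0 U0 by simp
  have "p * (1 - r) * ?P \<le> 1 * (4 / ?V)"
    using pqr P P0 by (intro mult_mono mult_le_one) auto
  moreover have "(1 - p) * (1 - q) * ?U \<le> 1 * (6 / ?V)"
    using pqr U U0 by (intro mult_mono mult_le_one) auto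
  moreover have "4 / ?V + 6 / ?V = 10 / ?V" by (simp flip: add_divide_distrib)
  ultimately show "g \<le> alpha2 p r * ?w + 10 / ?V"
    unfolding g by linarith
qed

end

section \<open>Almost sure growth of the statistics\<close>

locale three_interactions =
  fixes p q r :: real and M :: "'a measure" and X :: "nat \<Rightarrow> 'a \<Rightarrow> graph_state"
  assumes p: "0 < p" "p \<le> 1" and q: "0 \<le> q" "q \<le> 1" and r: "0 \<le> r" "r \<le> 1"
    and process: "three_interactions_process p q r M X"

sublocale three_interactions \<subseteq> pmf_chain M X "step p q r" initial_state
proof -
  interpret prob_space M using process by (simp add: three_interactions_process_def)
  show "pmf_chain M X (step p q r) initial_state"
    by unfold_locales (use process in \<open>auto simp: three_interactions_process_def\<close>)
qed

context three_interactions
begin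

lemma alpha_nonneg: "0 \<le> alpha p q r" and alpha_le_1: "alpha p q r \<le> 1" and alpha2_nonneg: "0 \<le> alpha2 p r"
proof -
  show "0 \<le> alpha p q r" "0 \<le> alpha2 p r" using p q r by (simp_all add: alpha_def alpha1_def alpha2_def)
  have "(1 - p) * q \<le> 1 - p" "p * r \<le> p" using p q r by (simp_all add: mult_left_le)
  then show "alpha p q r \<le> 1" unfolding alpha_def alpha1_def alpha2_def using p by linarith
qed

lemma AE_valid:
  "AE \<omega> in M. \<forall>n. valid_state n (X n \<omega>) \<and> (\<exists>T. card T = 3 \<and> X (Suc n) \<omega> = interact (X n \<omega>) T)"
  using AE_transition
proof eventually_elim
  case (elim \<omega>)
  have triple: "\<exists>T. card T = 3 \<and> X (Suc n) \<omega> = interact (X n \<omega>) T" if "valid_state n (X n \<omega>)" for n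
  proof -
    have "X (Suc n) \<omega> \<in> interact (X n \<omega>) ` set_pmf (interacting_triple p q r (X n \<omega>))"
      using elim by (simp add: step_def)
    then show ?thesis using card_interacting_triple[OF that] by blast
  qed
  have "valid_state n (X n \<omega>)" for n
  proof (induction n)
    case 0
    show ?case using elim valid_initial_state by simp
  next
    case (Suc n)
    then show ?case using triple[OF Suc] valid_interact[OF Suc] by auto
  qed
  with triple show ?case by blast
qed

lemma AE_vertices: "AE \<omega> in M. (\<lambda>n. real (card (vertices (X n \<omega>))) / real n) \<longlonglongrightarrow> p"
proof (rule statistic_growth[OF norming_of_nat, where c = 1])
  show "AE \<omega> in M. \<forall>k. card (vertices (X k \<omega>)) \<le> card (vertices (X (Suc k) \<omega>)) \<and>
      card (vertices (X (Suc k) \<omega>)) \<le> card (vertices (X k \<omega>)) + 1"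
    using AE_transition AE_valid
  proof eventually_elim
    case (elim \<omega>)
    show ?case
    proof
      fix k
      let ?s = "X k \<omega>" and ?t = "X (Suc k) \<omega>"
      have v: "valid_state k ?s" using elim by blast
      note fin = valid_stateD(1)[OF v]
      have "?t \<in> interact ?s ` set_pmf (interacting_triple p q r ?s)"
        using elim by (simp add: step_def)
      then obtain T where T: "T \<in> set_pmf (interacting_triple p q r ?s)" "?t = interact ?s T" by blast
      have "vertices ?s \<subseteq> vertices ?t" using T by (auto simp: interact_def)
      moreover have "vertices ?t \<subseteq> insert (new_vertex ?s) (vertices ?s)"
        using v T(1)
        by (cases rule: interacting_triple_cases) (auto simp: T(2) interact_def subsets_of_size_def)
      ultimately show "card (vertices ?s) \<le> card (vertices ?t) \<and> card (vertices ?t) \<le> card (vertices ?s) + 1"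
        using fin card_mono[of "vertices ?t" "vertices ?s"]
          card_mono[of "insert (new_vertex ?s) (vertices ?s)" "vertices ?t"]
        by (auto simp: card_insert_if intro: finite_subset split: if_splits)
    qed
  qed
  show "AE \<omega> in M. (\<lambda>n. measure_pmf.expectation (step p q r (X n \<omega>))
      (capped_gain 1 (\<lambda>s. card (vertices s)) (X n \<omega>)) / (real (Suc n) - real n)) \<longlonglongrightarrow> p"
    using AE_valid
  proof eventually_elim
    case (elim \<omega>)
    then have "measure_pmf.expectation (step p q r (X n \<omega>)) (capped_gain 1 (\<lambda>s. card (vertices s)) (X n \<omega>)) = p" for n
      using expected_new_vertices[OF _ less_imp_le[OF p(1)] p(2) q r] by blast
    then show ?case by simp
  qed
qed

context
  fixes j :: int and \<zeta> :: "'a \<Rightarrow> real"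
  assumes zeta_pos: "AE \<omega> in M. 0 < \<zeta> \<omega>"
    and weight_asymp: "AE \<omega> in M. (\<lambda>n. real (vertex_weight (X n \<omega>) j))
      \<sim>[sequentially] (\<lambda>n. \<zeta> \<omega> * real n powr alpha p q r)"
begin

lemma AE_weight_limit:
  "AE \<omega> in M. (\<lambda>n. real (vertex_weight (X n \<omega>) j) / real n powr alpha p q r) \<longlonglongrightarrow> \<zeta> \<omega>"
  using zeta_pos weight_asymp
proof eventually_elim
  case (elim \<omega>)
  let ?W = "\<lambda>n. real (vertex_weight (X n \<omega>) j)" and ?b = "\<lambda>n. real n powr alpha p q r"
  have nz: "eventually (\<lambda>n. ?W n \<noteq> 0 \<or> \<zeta> \<omega> * ?b n \<noteq> 0) sequentially"
    using eventually_gt_at_top[of 0] by eventually_elim (use elim(1) in auto)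
  have "(\<lambda>n. \<zeta> \<omega> * (?W n / (\<zeta> \<omega> * ?b n))) \<longlonglongrightarrow> \<zeta> \<omega> * 1"
    by (intro tendsto_mult_left asymp_equivD_strong[OF elim(2) nz])
  then show ?case using elim(1) by simp
qed

text \<open>
  The strictly positive limit forces a positive weight, and only existing vertices carry weight.
\<close>

lemma AE_vertex_present: "AE \<omega> in M. eventually (\<lambda>n. j \<in> vertices (X n \<omega>)) sequentially"
  using zeta_pos AE_weight_limit AE_valid
proof eventually_elim
  case (elim \<omega>)
  have "eventually (\<lambda>n. 0 < real (vertex_weight (X n \<omega>) j) / real n powr alpha p q r) sequentially"
    using elim(1,2) by (rule order_tendstoD(1)[rotated])
  then show ?case
  proof eventually_elim
    case (elim n)
    then have "vertex_weight (X n \<omega>) j \<noteq> 0" by (intro notI) simp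
    then have "{#T \<in># triangle_weights (X n \<omega>). j \<in> T#} \<noteq> {#}"
      unfolding vertex_weight_eq_size by (intro notI) simp
    then obtain T where "T \<in># triangle_weights (X n \<omega>)" "j \<in> T"
      by (auto elim: multiset_nonemptyE)
    moreover have "valid_state n (X n \<omega>)" using \<open>\<forall>n. valid_state n (X n \<omega>) \<and> _ n\<close> by blast
    ultimately show ?case using valid_stateD(7) by (auto simp: subsets_of_size_def)
  qed
qed

text \<open>
  The number of vertices grows linearly, so the error term for the expected gain is of order
  \<open>1 / n\<close>, which is negligible against the increments of \<open>n powr \<alpha>\<close>. The main term, divided by these increments, has
  the claimed limit since \<open>W n\<close> is about \<open>\<zeta> * n powr \<alpha>\<close> and the increments about \<open>\<alpha> * n powr \<alpha> / n\<close>.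
\<close>

lemma degree_growth:
  assumes pos: "0 < alpha p q r"
  shows "AE \<omega> in M. (\<lambda>n. real (vertex_degree (X n \<omega>) j) / real n powr alpha p q r)
    \<longlonglongrightarrow> alpha2 p r / alpha p q r * \<zeta> \<omega>"
proof (rule statistic_growth[OF norming_powr[OF pos alpha_le_1], where c = 2])
  show "AE \<omega> in M. \<forall>k. vertex_degree (X k \<omega>) j \<le> vertex_degree (X (Suc k) \<omega>) j \<and>
      vertex_degree (X (Suc k) \<omega>) j \<le> vertex_degree (X k \<omega>) j + 2"
    using AE_valid
  proof eventually_elim
    case (elim \<omega>)
    show ?case
    proof
      fix k
      obtain T where v: "valid_state k (X k \<omega>)" and T: "card T = 3" "X (Suc k) \<omega> = interact (X k \<omega>) T"
        using elim by blast
      show "vertex_degree (X k \<omega>) j \<le> vertex_degree (X (Suc k) \<omega>) j \<and>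
          vertex_degree (X (Suc k) \<omega>) j \<le> vertex_degree (X k \<omega>) j + 2"
        using vertex_degree_interact_bounds[OF v T(1), of j] by (auto simp: T(2) of_bool_def split: if_splits)
    qed
  qed
  let ?\<alpha> = "alpha p q r"
  let ?d = "\<lambda>n. real (Suc n) powr ?\<alpha> - real n powr ?\<alpha>"
  interpret norming "\<lambda>n. real n powr ?\<alpha>" 1 by (rule norming_powr[OF pos alpha_le_1])
  have d_pos: "?d n > 0" for n using b_less_Suc[of n] by simp
  have ratio: "(\<lambda>n. real n powr ?\<alpha> / real (Suc n) / ?d n) \<longlonglongrightarrow> 1 / ?\<alpha>"
    using pos by (real_asymp simp: field_simps)
  have small: "(\<lambda>n. 1 / (real n * ?d n)) \<longlonglongrightarrow> 0"
    using pos by real_asymp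
  show "AE \<omega> in M. (\<lambda>n. measure_pmf.expectation (step p q r (X n \<omega>))
      (capped_gain 2 (\<lambda>s. vertex_degree s j) (X n \<omega>)) / ?d n) \<longlonglongrightarrow> alpha2 p r / ?\<alpha> * \<zeta> \<omega>"
    using AE_valid AE_vertices AE_weight_limit AE_vertex_present
  proof eventually_elim
    case (elim \<omega>)
    let ?w = "\<lambda>n. real (vertex_weight (X n \<omega>) j)" and ?V = "\<lambda>n. real (card (vertices (X n \<omega>)))"
    let ?g = "\<lambda>n. measure_pmf.expectation (step p q r (X n \<omega>)) (capped_gain 2 (\<lambda>s. vertex_degree s j) (X n \<omega>))"
    have "(\<lambda>n. alpha2 p r * ((?w n / real n powr ?\<alpha>) * (real n powr ?\<alpha> / real (Suc n) / ?d n)))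
        \<longlonglongrightarrow> alpha2 p r * (\<zeta> \<omega> * (1 / ?\<alpha>))"
      by (intro tendsto_intros elim ratio)
    moreover have "eventually (\<lambda>n. alpha2 p r * ((?w n / real n powr ?\<alpha>) * (real n powr ?\<alpha> / real (Suc n) / ?d n))
        = alpha2 p r * (?w n / real (Suc n)) / ?d n) sequentially"
      using eventually_gt_at_top[of 0] by eventually_elim simp
    ultimately have "(\<lambda>n. alpha2 p r * (?w n / real (Suc n)) / ?d n) \<longlonglongrightarrow> alpha2 p r * (\<zeta> \<omega> * (1 / ?\<alpha>))"
      by (rule Lim_transform_eventually)
    moreover have "alpha2 p r * (\<zeta> \<omega> * (1 / ?\<alpha>)) = alpha2 p r / ?\<alpha> * \<zeta> \<omega>" by simp
    ultimately have lower: "(\<lambda>n. alpha2 p r * (?w n / real (Suc n)) / ?d n) \<longlonglongrightarrow> alpha2 p r / ?\<alpha> * \<zeta> \<omega>"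
      by (simp only:)
    have "(\<lambda>n. 10 * (inverse (?V n / real n) * (1 / (real n * ?d n)))) \<longlonglongrightarrow> 10 * (inverse p * 0)"
      using p by (intro tendsto_intros elim small) simp
    moreover have "eventually (\<lambda>n. 10 * (inverse (?V n / real n) * (1 / (real n * ?d n)))
        = 10 / ?V n / ?d n) sequentially"
      using eventually_gt_at_top[of 0] by eventually_elim simp
    ultimately have "(\<lambda>n. 10 / ?V n / ?d n) \<longlonglongrightarrow> 10 * (inverse p * 0)"
      by (rule Lim_transform_eventually)
    then have "(\<lambda>n. 10 / ?V n / ?d n) \<longlonglongrightarrow> 0" by simp
    from tendsto_add[OF lower this]
    have upper: "(\<lambda>n. alpha2 p r * (?w n / real (Suc n)) / ?d n + 10 / ?V n / ?d n)
        \<longlonglongrightarrow> alpha2 p r / ?\<alpha> * \<zeta> \<omega>" by simp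
    have bounds: "eventually (\<lambda>n. alpha2 p r * (?w n / real (Suc n)) / ?d n \<le> ?g n / ?d n \<and>
        ?g n / ?d n \<le> alpha2 p r * (?w n / real (Suc n)) / ?d n + 10 / ?V n / ?d n) sequentially"
      using elim(4)
    proof eventually_elim
      case (elim n)
      have v: "valid_state n (X n \<omega>)" using \<open>\<forall>n. valid_state n (X n \<omega>) \<and> _ n\<close> by blast
      note g = expected_degree_gain[OF v less_imp_le[OF p(1)] p(2) q r elim]
      show ?case
        unfolding add_divide_distrib[symmetric]
        by (intro conjI divide_right_mono g less_imp_le[OF d_pos])
    qed
    show ?case
      by (rule tendsto_sandwich[OF _ _ lower upper]) (use bounds in \<open>auto elim: eventually_mono\<close>)
  qed
qed

text \<open>
  If \<open>\<alpha> = 0\<close> there is no weight-driven selection at all; a vertex is then hit at step \<open>n\<close> with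
  probability of order \<open>1 / n\<close>, so its weight grows like \<open>ln n\<close>. This contradicts the assumed
  convergence to the finite limit \<open>\<zeta>\<close>, so the hypothesis on the weight already excludes this case.
\<close>

lemma alpha_pos: "0 < alpha p q r"
proof (rule ccontr)
  assume "\<not> 0 < alpha p q r"
  then have zero: "alpha p q r = 0" using alpha_nonneg by simp
  define \<beta> where "\<beta> = 2 * p * (1 - r) + 3 * (1 - p) * (1 - q)"
  have "2 * p * r = 0"
    using zero p q r mult_nonneg_nonneg[of "1 - p" q] by (simp add: alpha_def alpha1_def alpha2_def add_nonneg_eq_0_iff)
  then have "r = 0" using p by simp
  then have \<beta>: "0 < \<beta>" unfolding \<beta>_def using p q by (simp add: add_pos_nonneg)
  let ?d = "\<lambda>n. ln (real (Suc n) + 1) - ln (real n + 1)"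
  have small: "(\<lambda>n. 1 / (real n * ?d n)) \<longlonglongrightarrow> 1" by real_asymp
  have "AE \<omega> in M. (\<lambda>n. real (vertex_weight (X n \<omega>) j) / ln (real n + 1)) \<longlonglongrightarrow> \<beta> / p"
  proof (rule statistic_growth[OF norming_ln, where c = 1])
    show "AE \<omega> in M. \<forall>k. vertex_weight (X k \<omega>) j \<le> vertex_weight (X (Suc k) \<omega>) j \<and>
        vertex_weight (X (Suc k) \<omega>) j \<le> vertex_weight (X k \<omega>) j + 1"
      using AE_valid
    proof eventually_elim
      case (elim \<omega>)
      show ?case
      proof
        fix k
        obtain T where "X (Suc k) \<omega> = interact (X k \<omega>) T" using elim by blast
        then show "vertex_weight (X k \<omega>) j \<le> vertex_weight (X (Suc k) \<omega>) j \<and>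
            vertex_weight (X (Suc k) \<omega>) j \<le> vertex_weight (X k \<omega>) j + 1"
          by (simp add: vertex_weight_interact)
      qed
    qed
    show "AE \<omega> in M. (\<lambda>n. measure_pmf.expectation (step p q r (X n \<omega>))
        (capped_gain 1 (\<lambda>s. vertex_weight s j) (X n \<omega>)) / ?d n) \<longlonglongrightarrow> \<beta> / p"
      using AE_valid AE_vertices AE_vertex_present
    proof eventually_elim
      case (elim \<omega>)
      let ?V = "\<lambda>n. real (card (vertices (X n \<omega>)))"
      have "(\<lambda>n. \<beta> * (inverse (?V n / real n) * (1 / (real n * ?d n)))) \<longlonglongrightarrow> \<beta> * (inverse p * 1)"
        using p by (intro tendsto_intros elim small) simp
      moreover have "eventually (\<lambda>n. \<beta> * (inverse (?V n / real n) * (1 / (real n * ?d n)))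
          = measure_pmf.expectation (step p q r (X n \<omega>)) (capped_gain 1 (\<lambda>s. vertex_weight s j) (X n \<omega>)) / ?d n)
          sequentially"
        using elim(3) eventually_gt_at_top[of 0]
      proof eventually_elim
        case (elim n)
        have v: "valid_state n (X n \<omega>)" using \<open>\<forall>n. valid_state n (X n \<omega>) \<and> _ n\<close> by blast
        have "measure_pmf.expectation (step p q r (X n \<omega>)) (capped_gain 1 (\<lambda>s. vertex_weight s j) (X n \<omega>)) = \<beta> / ?V n"
          using expected_weight_gain[OF v less_imp_le[OF p(1)] p(2) q r elim(1)] zero by (simp add: \<beta>_def)
        then show ?case using elim(2) by simp
      qed
      ultimately have "(\<lambda>n. measure_pmf.expectation (step p q r (X n \<omega>))
          (capped_gain 1 (\<lambda>s. vertex_weight s j) (X n \<omega>)) / ?d n) \<longlonglongrightarrow> \<beta> * (inverse p * 1)"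
        by (rule Lim_transform_eventually)
      then show ?case by (simp add: divide_inverse)
    qed
  qed
  then have "AE \<omega> in M. False"
    using AE_weight_limit
  proof eventually_elim
    case (elim \<omega>)
    let ?W = "\<lambda>n. real (vertex_weight (X n \<omega>) j)"
    have "?W \<longlonglongrightarrow> \<zeta> \<omega>"
      using elim(2)
      by (rule Lim_transform_eventually)
         (use eventually_gt_at_top[of 0] in eventually_elim, simp add: zero)
    moreover have "filterlim (\<lambda>n. ln (real n + 1)) at_infinity sequentially" by real_asymp
    ultimately have "(\<lambda>n. ?W n / ln (real n + 1)) \<longlonglongrightarrow> 0"
      by (rule tendsto_divide_0)
    from LIMSEQ_unique[OF this elim(1)] show False using \<beta> p by simp
  qed
  then show False by simp
qed

end

end

theorem theorem5p2:
  fixes p q r :: real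
    and M :: "'a measure"
    and X :: "nat \<Rightarrow> 'a \<Rightarrow> graph_state"
    and j :: nat
    and \<zeta> :: "'a \<Rightarrow> real"
  assumes "0 < p" "p \<le> 1" "0 \<le> q" "q \<le> 1" "0 \<le> r" "r \<le> 1"
    and "three_interactions_process p q r M X"
    and "\<zeta> \<in> borel_measurable M"
    and "AE \<omega> in M. 0 < \<zeta> \<omega>"
    and "AE \<omega> in M. (\<lambda>n. real (vertex_weight (X n \<omega>) (int j)))
           \<sim>[sequentially] (\<lambda>n. \<zeta> \<omega> * real n powr alpha p q r)"
  shows "AE \<omega> in M.
           if alpha2 p r = 0
           then (\<lambda>n. real (vertex_degree (X n \<omega>) (int j)))
                  \<in> o[sequentially](\<lambda>n. real n powr alpha p q r)
           else (\<lambda>n. real (vertex_degree (X n \<omega>) (int j)))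
                  \<sim>[sequentially]
                (\<lambda>n. alpha2 p r / alpha p q r * \<zeta> \<omega> * real n powr alpha p q r)"
proof -
  interpret three_interactions p q r M X using assms by unfold_locales
  note pos = alpha_pos[OF assms(9,10)]
  show ?thesis
    using degree_growth[OF assms(9,10) pos] assms(9)
  proof eventually_elim
    case (elim \<omega>)
    let ?D = "\<lambda>n. real (vertex_degree (X n \<omega>) (int j))" and ?b = "\<lambda>n. real n powr alpha p q r"
    have b: "eventually (\<lambda>n. ?b n \<noteq> 0) sequentially"
      using eventually_gt_at_top[of 0] by eventually_elim simp
    show ?case
    proof (cases "alpha2 p r = 0")
      case True
      then have "(\<lambda>n. ?D n / ?b n) \<longlonglongrightarrow> 0" using elim(1) by simp
      then show ?thesis using True b by (simp add: smalloI_tendsto)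
    next
      case False
      define c where "c = alpha2 p r / alpha p q r * \<zeta> \<omega>"
      have c: "c \<noteq> 0" using False pos elim(2) by (simp add: c_def)
      have "(\<lambda>n. ?D n / ?b n / c) \<longlonglongrightarrow> c / c"
        by (intro tendsto_divide elim(1)[folded c_def] tendsto_const c)
      then have "(\<lambda>n. ?D n / (c * ?b n)) \<longlonglongrightarrow> 1"
        using c by (simp add: mult.commute)
      then have "?D \<sim>[sequentially] (\<lambda>n. c * ?b n)" by (rule asymp_equivI')
      then show ?thesis using False by (simp add: c_def)
    qed
  qed
qed

end
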